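(* Let $K$ be a field, let $A$ be a configuration of $K[t_1,\ldots,t_d]$ all of whose monomials have the same total degree $r$ and such that every variable $t_i$ divides at least one monomial of $A$, and for each $1\le i\le d$ let $B_i$ be a configuration of a polynomial ring $K[\mathbf{u}^{(i)}]=K[u^{(i)}_1,\ldots,u^{(i)}_{\mu_i}]$. (a) If $p$ is a positive integer and each of the toric ideals $I_A,I_{B_1},\ldots,I_{B_d}$ possesses a Gröbner basis (each with respect to some monomial order) consisting of binomials of degree at most $p$, then $I_{A(B_1,\ldots,B_d)}$ possesses a Gröbner basis, with respect to some monomial order, consisting of binomials of degree at most $\max(2,p)$. (b) If each of $I_A,I_{B_1},\ldots,I_{B_d}$ possesses a squarefree initial ideal (each with respect to some monomial order), then $I_{A(B_1,\ldots,B_d)}$ possesses a squarefree initial ideal with respect to some monomial order.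
   Context: A configuration of a polynomial ring $K[t_1,\ldots,t_d]$ is a finite set $A=\{\mathbf{t}^{\mathbf{a}_1},\ldots,\mathbf{t}^{\mathbf{a}_n}\}$ of (distinct) monomials such that there is $\mathbf{w}\in\mathbb{R}^d$ with $\mathbf{w}\cdot\mathbf{a}_i=1$ for all $i$. The toric ideal $I_A$ is the kernel of the $K$-algebra homomorphism $K[x_1,\ldots,x_n]\to K[t_1,\ldots,t_d]$, $x_i\mapsto\mathbf{t}^{\mathbf{a}_i}$ (one variable of degree 1 for each element of the configuration). An initial ideal is squarefree if it is generated by squarefree monomials. A binomial is a difference of two monomials. Nested configuration: write $B_i=\{m^{(i)}_1,\ldots,m^{(i)}_{\lambda_i}\}$, where the polynomial rings $K[\mathbf{u}^{(1)}],\ldots,K[\mathbf{u}^{(d)}]$ have pairwise disjoint sets of variables. Then $$A(B_1,\ldots,B_d)=\{m^{(i_1)}_{j_1}\cdots m^{(i_r)}_{j_r} : t_{i_1}\cdots t_{i_r}\in A,\ 1\le j_k\le\lambda_{i_k}\text{ for }1\le k\le r\},$$ a configuration of $K[\mathbf{u}^{(1)},\ldots,\mathbf{u}^{(d)}]$ (here $t_{i_1}\cdots t_{i_r}$ need not be squarefree). *)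

theory Defs
  imports Complex_Main "HOL-Library.Poly_Mapping" "HOL-Algebra.RingHom"
begin

section \<open>Polynomial rings in a set of variables\<close>

text \<open>
  A monomial in variables of type \<open>'v\<close> is identified with its finitely supported exponent vector,
  written additively: the product of monomials is \<open>+\<close> and the monomial \<open>1\<close> is \<open>0\<close>. The ring
  \<open>mpoly_ring X\<close> is \<open>K[X]\<close> for a set \<open>X\<close> of variables, where \<open>K\<close> is a type of class \<open>field\<close>.
\<close>

type_synonym 'v mon = "'v \<Rightarrow>\<^sub>0 nat"
type_synonym ('v, 'k) mpol = "'v mon \<Rightarrow>\<^sub>0 'k"

abbreviation "keys \<equiv> Poly_Mapping.keys"
abbreviation "lookup \<equiv> Poly_Mapping.lookup"

definition monomials :: "'v set \<Rightarrow> 'v mon set" where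
  "monomials X = {m. keys m \<subseteq> X}"

definition mpoly_ring :: "'v set \<Rightarrow> ('v, 'k::field) mpol ring" where
  "mpoly_ring X = \<lparr>carrier = {f. keys f \<subseteq> monomials X}, monoid.mult = (*), one = 1,
                   ring.zero = 0, add = (+)\<rparr>"

definition mono_poly :: "'v mon \<Rightarrow> ('v, 'k::field) mpol" where
  "mono_poly m = Poly_Mapping.single m 1"

definition mon_degree :: "'v mon \<Rightarrow> nat" where
  "mon_degree m = (\<Sum>x\<in>keys m. lookup m x)"

text \<open>The total degree, every variable having degree 1; the zero polynomial gets degree 0.\<close>

definition total_degree :: "('v, 'k::field) mpol \<Rightarrow> nat" where
  "total_degree f = Max (insert 0 (mon_degree ` keys f))"

definition squarefree_mon :: "'v mon \<Rightarrow> bool" where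
  "squarefree_mon m \<longleftrightarrow> (\<forall>x. lookup m x \<le> 1)"

definition is_binomial :: "('v, 'k::field) mpol \<Rightarrow> bool" where
  "is_binomial f \<longleftrightarrow> (\<exists>u v. f = mono_poly u - mono_poly v)"

definition poly_subst :: "('v \<Rightarrow> ('w, 'k::field) mpol) \<Rightarrow> ('v, 'k) mpol \<Rightarrow> ('w, 'k) mpol" where
  "poly_subst \<sigma> f =
     (\<Sum>m\<in>keys f. Poly_Mapping.single 0 (lookup f m) * (\<Prod>x\<in>keys m. \<sigma> x ^ lookup m x))"

text \<open>
  The ideals below are generated in \<open>mpoly_ring X\<close> by the library's \<open>genideal\<close>, an intersection
  over all ideals of that structure, so it matters that the structure is a ring.
\<close>

lemma cring_mpoly_ring:
  fixes X :: "'v set"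
  shows "cring (mpoly_ring X :: ('v, 'k::field) mpol ring)"
proof -
  have mult_closed: "keys (f * g) \<subseteq> monomials X"
    if "keys f \<subseteq> monomials X" "keys g \<subseteq> monomials X" for f g :: "('v, 'k) mpol"
  proof
    fix m assume "m \<in> keys (f * g)"
    then obtain a b where "m = a + b" "a \<in> keys f" "b \<in> keys g"
      using keys_mult[of f g] by auto
    then show "m \<in> monomials X"
      using that keys_add[of a b] by (fastforce simp: monomials_def)
  qed
  have add_closed: "keys (f + g) \<subseteq> monomials X"
    if "keys f \<subseteq> monomials X" "keys g \<subseteq> monomials X" for f g :: "('v, 'k) mpol"
    using that keys_add[of f g] by blast
  have "abelian_group (mpoly_ring X :: ('v, 'k) mpol ring)"
  proof (rule abelian_groupI)
    fix f :: "('v, 'k) mpol"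
    assume "f \<in> carrier (mpoly_ring X)"
    then show "\<exists>g\<in>carrier (mpoly_ring X). g \<oplus>\<^bsub>mpoly_ring X\<^esub> f = \<zero>\<^bsub>mpoly_ring X\<^esub>"
      by (intro bexI[of _ "- f"]) (auto simp: mpoly_ring_def)
  qed (use add_closed in \<open>auto simp: mpoly_ring_def algebra_simps\<close>)
  moreover have "Group.comm_monoid (mpoly_ring X :: ('v, 'k) mpol ring)"
    by (rule comm_monoidI)
       (use mult_closed in \<open>auto simp: mpoly_ring_def monomials_def algebra_simps\<close>)
  ultimately show ?thesis
    by (rule cringI) (auto simp: mpoly_ring_def algebra_simps)
qed

section \<open>Monomial orders, initial ideals and Groebner bases\<close>

text \<open>
  \<open>(u, v) \<in> R\<close> means \<open>u \<le> v\<close>. For finite \<open>X\<close> such an order is automatically a well-order.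
\<close>

definition monomial_order :: "'v set \<Rightarrow> 'v mon rel \<Rightarrow> bool" where
  "monomial_order X R \<longleftrightarrow>
     linear_order_on (monomials X) R \<and>
     (\<forall>u\<in>monomials X. (0, u) \<in> R) \<and>
     (\<forall>u v. \<forall>w\<in>monomials X. (u, v) \<in> R \<longrightarrow> (u + w, v + w) \<in> R)"

definition initial_mon :: "'v mon rel \<Rightarrow> ('v, 'k::field) mpol \<Rightarrow> 'v mon" where
  "initial_mon R f = (THE m. m \<in> keys f \<and> (\<forall>u\<in>keys f. (u, m) \<in> R))"

definition initial_ideal ::
  "'v set \<Rightarrow> 'v mon rel \<Rightarrow> ('v, 'k::field) mpol set \<Rightarrow> ('v, 'k) mpol set" where
  "initial_ideal X R I = Idl\<^bsub>mpoly_ring X\<^esub> {mono_poly (initial_mon R f) | f. f \<in> I \<and> f \<noteq> 0}"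

definition groebner_basis ::
  "'v set \<Rightarrow> 'v mon rel \<Rightarrow> ('v, 'k::field) mpol set \<Rightarrow> ('v, 'k) mpol set \<Rightarrow> bool" where
  "groebner_basis X R I G \<longleftrightarrow>
     finite G \<and> G \<subseteq> I \<and> 0 \<notin> G \<and>
     Idl\<^bsub>mpoly_ring X\<^esub> {mono_poly (initial_mon R g) | g. g \<in> G} = initial_ideal X R I"

definition squarefree_ideal :: "'v set \<Rightarrow> ('v, 'k::field) mpol set \<Rightarrow> bool" where
  "squarefree_ideal X J \<longleftrightarrow>
     (\<exists>S \<subseteq> monomials X. (\<forall>m\<in>S. squarefree_mon m) \<and> J = Idl\<^bsub>mpoly_ring X\<^esub> (mono_poly ` S))"

definition has_binomial_groebner_basis :: "'v set \<Rightarrow> ('v, 'k::field) mpol set \<Rightarrow> nat \<Rightarrow> bool" where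
  "has_binomial_groebner_basis X I p \<longleftrightarrow>
     (\<exists>R G. monomial_order X R \<and> groebner_basis X R I G \<and>
            (\<forall>g\<in>G. is_binomial g \<and> total_degree g \<le> p))"

definition has_squarefree_initial_ideal :: "'v set \<Rightarrow> ('v, 'k::field) mpol set \<Rightarrow> bool" where
  "has_squarefree_initial_ideal X I \<longleftrightarrow>
     (\<exists>R. monomial_order X R \<and> squarefree_ideal X (initial_ideal X R I))"

section \<open>Configurations and toric ideals\<close>

definition configuration :: "'v set \<Rightarrow> 'v mon set \<Rightarrow> bool" where
  "configuration V A \<longleftrightarrow>
     finite A \<and> A \<subseteq> monomials V \<and>
     (\<exists>w :: 'v \<Rightarrow> real. \<forall>a\<in>A. (\<Sum>v\<in>V. w v * real (lookup a v)) = 1)"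

text \<open>
  The variables \<open>x\<^sub>1, \<dots>, x\<^sub>n\<close> of the toric ring are indexed by the monomials of \<open>A\<close> themselves,
  so the toric ideal lives in \<open>mpoly_ring A\<close>. The first argument only fixes the field \<open>K\<close>.
\<close>

definition toric_hom :: "('v mon, 'k::field) mpol \<Rightarrow> ('v, 'k) mpol" where
  "toric_hom = poly_subst mono_poly"

definition toric_ideal ::
  "'k::field itself \<Rightarrow> 'v set \<Rightarrow> 'v mon set \<Rightarrow> ('v mon, 'k) mpol set" where
  "toric_ideal K V A = a_kernel (mpoly_ring A) (mpoly_ring V) toric_hom"

text \<open>
  The argument \<open>r\<close> is the common degree of the monomials of \<open>A\<close>. A factorisation
  \<open>t\<^bsub>i 1\<^esub> \<cdots> t\<^bsub>i r\<^esub>\<close> of a monomial may repeat variables, and a repeated variable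
  may be replaced by different elements of the same \<open>B i\<close>.
\<close>

definition nested_configuration ::
  "nat \<Rightarrow> 't mon set \<Rightarrow> ('t \<Rightarrow> 'u mon set) \<Rightarrow> 'u mon set" where
  "nested_configuration r A B =
     {(\<Sum>k=1..r. m k) | i m.
        (\<Sum>k=1..r. Poly_Mapping.single (i k) 1) \<in> A \<and> (\<forall>k\<in>{1..r}. m k \<in> B (i k))}"

end

theory Submission
  imports Defs "HOL-Library.Product_Lexorder"
begin

text \<open>
  A monomial lies in the initial ideal of a toric ideal iff it is not the least element of its fibre
  under \<open>toric_mon\<close>, so both hypotheses say that the nonstandard monomials are generated, under
  divisibility, by monomials of small degree resp. by squarefree ones; the field plays no role.

  Let \<open>C\<close> be the union of the \<open>B i\<close>. Writing each element of the nested configuration in its standard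
  form over \<open>C\<close>, a monomial \<open>u\<close> in the nested variables has a multiset of shapes (a monomial over \<open>A\<close>)
  and a multiset of letters (a monomial over \<open>C\<close>). Compare monomials lexicographically: first the
  shapes by the order for \<open>A\<close>, then the letters by the order for \<open>C\<close>, then by two weights. The first
  weight makes smaller shapes receive smaller letters of each block; the second, a sum of squares of
  letter counts, makes the letters balanced among variables of equal shape (Sturmfels' sorting). If
  shapes and letters are standard and all pairs of variables are sorted in this sense, then \<open>u\<close> is
  determined by its fibre. Hence a nonstandard \<open>u\<close> has a nonstandard divisor that comes from a generator
  for \<open>A\<close>, from a generator for \<open>C\<close>, or is a product of two distinct variables.
\<close>

text \<open>An element of the nested configuration may factor into letters in many ways. Only the
  number of letters from each block is invariant: the weight vector of \<open>B i\<close> gives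
  every letter of block i the value 1, so that number can be read off the product. This makes the
  shape of an element well defined. Conversely, divisors of a standard monomial are standard, so the
  letters of a standard monomial may be redistributed freely within each block, and it is this
  freedom that the two weights have to remove. There are two weights because letter counts can be
  compared only between variables of equal shape: different shapes draw unequally often on the
  blocks. Balancing is tested on differences of initial segments of \<open>C\<close> because every
  block is such a difference, so that balancing two variables keeps their shapes. Uniqueness comes
  by cancellation. Within the least shape some variable has the largest count on all initial
  segments at once, and this count is the rounded-up average, hence forced. Every exchange involves
  just two variables, which is the origin of the 2 in \<open>max 2 p\<close>.\<close>

section \<open>Monomials and additive extensions\<close>

text \<open>The additive map on exponent vectors that sends the variable x to
  \<open>\<tau> x\<close>. The inner sum over \<open>j<lookup m x\<close> is the multiple by a
  natural number in an arbitrary commutative monoid, so that one definition serves for monomials,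
  natural numbers and reals.\<close>

definition lin_ext :: "('a \<Rightarrow> 'm::comm_monoid_add) \<Rightarrow> 'a mon \<Rightarrow> 'm" where
  "lin_ext \<tau> m = (\<Sum>x\<in>keys m. \<Sum>j<lookup m x. \<tau> x)"

definition divides :: "'a mon \<Rightarrow> 'a mon \<Rightarrow> bool" where
  "divides s u \<longleftrightarrow> (\<forall>x. lookup s x \<le> lookup u x)"

lemma lin_ext_superset:
  assumes "finite S" "keys m \<subseteq> S"
  shows "lin_ext \<tau> m = (\<Sum>x\<in>S. \<Sum>j<lookup m x. \<tau> x)"
  unfolding lin_ext_def
  by (rule sum.mono_neutral_left) (use assms in \<open>auto simp: in_keys_iff\<close>)

lemma lin_ext_zero [simp]: "lin_ext \<tau> 0 = 0"
  by (simp add: lin_ext_def)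

lemma sum_const_add:
  fixes c :: "'m::comm_monoid_add" and a b :: nat
  shows "(\<Sum>j<a + b. c) = (\<Sum>j<a. c) + (\<Sum>j<b. c)"
  by (induction b) (auto simp: algebra_simps)

lemma lin_ext_add: "lin_ext \<tau> (m + m') = lin_ext \<tau> m + lin_ext \<tau> m'"
proof -
  have k: "keys (m + m') \<subseteq> keys m \<union> keys m'" by (rule keys_add)
  show ?thesis
    by (subst (1 2 3) lin_ext_superset[of "keys m \<union> keys m'"])
       (use k in \<open>auto simp: lookup_add sum_const_add sum.distrib\<close>)
qed

lemma lin_ext_single [simp]: "lin_ext \<tau> (Poly_Mapping.single x 1) = \<tau> x"
  by (simp add: lin_ext_def)

lemma lin_ext_single_Suc0 [simp]: "lin_ext \<tau> (Poly_Mapping.single x (Suc 0)) = \<tau> x"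
  using lin_ext_single[of \<tau> x] by simp

lemma lin_ext_cong: "(\<And>x. x \<in> keys m \<Longrightarrow> \<tau> x = \<tau>' x) \<Longrightarrow> lin_ext \<tau> m = lin_ext \<tau>' m"
  by (simp add: lin_ext_def)

lemma lin_ext_sum: "lin_ext \<tau> (\<Sum>k\<in>S. f k) = (\<Sum>k\<in>S. lin_ext \<tau> (f k))"
  by (induction S rule: infinite_finite_induct) (auto simp: lin_ext_add)

lemma sub_single_add:
  "x \<in> keys m \<Longrightarrow> m = (m - Poly_Mapping.single x 1) + Poly_Mapping.single x (1::nat)"
  by (rule poly_mapping_eqI) (auto simp: lookup_add lookup_minus lookup_single when_def in_keys_iff)

lemma mon_induct [case_names zero add]:
  fixes u :: "'a mon"
  assumes "P 0" and "\<And>m x. P m \<Longrightarrow> x \<in> keys u \<Longrightarrow> keys m \<subseteq> keys u \<Longrightarrow> P (m + Poly_Mapping.single x 1)"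
  shows "P u"
proof -
  have "keys m \<subseteq> keys u \<Longrightarrow> P m" for m :: "'a mon"
  proof (induction "\<Sum>x\<in>keys u. lookup m x" arbitrary: m rule: less_induct)
    case less
    show ?case
    proof (cases "m = 0")
      case True then show ?thesis using assms(1) by simp
    next
      case False
      then obtain x where x: "x \<in> keys m"
        by (metis keys_eq_empty ex_in_conv)
      let ?m = "m - Poly_Mapping.single x 1"
      have sub: "keys ?m \<subseteq> keys m"
        by (auto simp: in_keys_iff lookup_minus)
      have "0 < lookup m x" using x by (simp add: in_keys_iff)
      have "x \<in> keys u" using x less.prems by blast
      have "(\<Sum>y\<in>keys u. lookup ?m y) < (\<Sum>y\<in>keys u. lookup m y)"
      proof (rule sum_strict_mono_ex1)
        show "\<exists>y\<in>keys u. lookup ?m y < lookup m y"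
          by (rule bexI[of _ x]) (use \<open>0 < lookup m x\<close> \<open>x \<in> keys u\<close> in \<open>simp_all add: lookup_minus\<close>)
      qed (simp_all add: lookup_minus)
      then have "P ?m"
        using less.hyps sub less.prems by blast
      then have "P (?m + Poly_Mapping.single x 1)"
        using assms(2) x sub less.prems by blast
      then show ?thesis using sub_single_add[OF x] by simp
    qed
  qed
  then show ?thesis by blast
qed

lemma lin_ext_lin_ext: "lin_ext \<tau> (lin_ext \<rho> m) = lin_ext (\<lambda>x. lin_ext \<tau> (\<rho> x)) m"
  by (induction m rule: mon_induct) (simp_all add: lin_ext_add)

lemma lin_ext_hom:
  assumes "h 0 = 0" "\<And>x y. h (x + y) = h x + h y"
  shows "h (lin_ext \<rho> m) = lin_ext (\<lambda>x. h (\<rho> x)) m"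
  by (induction m rule: mon_induct) (simp_all add: lin_ext_add assms)

lemma lin_ext_nat: "lin_ext \<tau> m = (\<Sum>x\<in>keys m. lookup m x * \<tau> x)" for \<tau> :: "'a \<Rightarrow> nat"
  by (simp add: lin_ext_def)

lemma lookup_lin_ext: "lookup (lin_ext \<tau> m) y = lin_ext (\<lambda>x. lookup (\<tau> x) y) m"
  by (rule lin_ext_hom) (auto simp: lookup_add)

section \<open>Degree, support and divisibility of monomials\<close>

lemma mon_degree_lin_ext: "mon_degree m = lin_ext (\<lambda>_. 1) m"
  by (simp add: mon_degree_def lin_ext_nat)

lemma mon_degree_add: "mon_degree (m + m') = mon_degree m + mon_degree m'"
  by (simp add: mon_degree_lin_ext lin_ext_add)

lemma mon_degree_zero [simp]: "mon_degree 0 = 0"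
  by (simp add: mon_degree_lin_ext)

lemma mon_degree_single [simp]: "mon_degree (Poly_Mapping.single x 1) = 1"
  by (simp add: mon_degree_lin_ext del: One_nat_def)

lemma mon_degree_lin_ext_eq:
  "mon_degree (lin_ext \<tau> m) = lin_ext (\<lambda>x. mon_degree (\<tau> x)) m"
  by (rule lin_ext_hom) (auto simp: mon_degree_add)

lemma mon_degree_eq_0_iff [simp]: "mon_degree m = 0 \<longleftrightarrow> m = 0"
proof
  assume "mon_degree m = 0"
  then show "m = 0"
    by (intro poly_mapping_eqI) (auto simp: mon_degree_def in_keys_iff)
qed simp

lemma lookup_le_mon_degree: "lookup m x \<le> mon_degree m"
proof (cases "x \<in> keys m")
  case True
  then show ?thesis unfolding mon_degree_def by (intro member_le_sum) auto
qed (simp add: in_keys_iff)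

lemma monomials_zero [simp]: "0 \<in> monomials X"
  by (simp add: monomials_def)

lemma keys_add_nat: "keys (u + v) = keys u \<union> keys v" for u v :: "'a mon"
  by (auto simp: in_keys_iff lookup_add)

lemma monomials_add [simp]: "u + v \<in> monomials X \<longleftrightarrow> u \<in> monomials X \<and> v \<in> monomials X"
  by (auto simp: monomials_def keys_add_nat)

lemma monomials_single [simp]: "Poly_Mapping.single x (Suc 0) \<in> monomials X \<longleftrightarrow> x \<in> X"
  by (simp add: monomials_def)

lemma divides_add [simp]: "divides s (s + w)" "divides s (w + s)"
  by (auto simp: divides_def lookup_add)

lemma divides_diff: "divides s u \<Longrightarrow> u = s + (u - s)"
  by (rule poly_mapping_eqI) (auto simp: divides_def lookup_add lookup_minus)

lemma divides_iff: "divides s u \<longleftrightarrow> (\<exists>w. u = s + w)"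
  using divides_diff by auto

lemma divides_refl [simp]: "divides s s"
  by (simp add: divides_def)

lemma divides_trans: "divides a b \<Longrightarrow> divides b c \<Longrightarrow> divides a c"
  unfolding divides_def by (meson le_trans)

lemma divides_monomials: "divides s u \<Longrightarrow> u \<in> monomials X \<Longrightarrow> s \<in> monomials X"
  by (auto simp: divides_iff)

lemma finite_monomials_bounded:
  assumes "finite X"
  shows "finite {m \<in> monomials X. mon_degree m \<le> q}" (is "finite ?M")
proof -
  define F where "F = {f. \<forall>x. (x \<in> X \<longrightarrow> f x \<in> {..q}) \<and> (x \<notin> X \<longrightarrow> f x = 0)}"
  have "lookup ` ?M \<subseteq> F"
  proof (rule image_subsetI)
    fix m assume m: "m \<in> ?M"
    have "mon_degree m \<le> q" using m by simp
    then have "lookup m x \<le> q" for x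
      by (rule le_trans[OF lookup_le_mon_degree])
    moreover have "x \<notin> X \<Longrightarrow> lookup m x = 0" for x
      using m not_in_keys_iff_lookup_eq_zero[of x m] unfolding monomials_def by blast
    ultimately show "lookup m \<in> F" by (simp add: F_def)
  qed
  moreover have "finite F"
    unfolding F_def using finite_set_of_finite_funs[OF assms finite_atMost] .
  ultimately have "finite (lookup ` ?M)"
    by (rule finite_subset)
  moreover have "inj_on lookup ?M"
    by (rule inj_onI) (simp only: poly_mapping.lookup_inject)
  ultimately show ?thesis by (rule finite_imageD)
qed

text \<open>The relation is arbitrary, to cover maxima and minima for monomial orders as well as the
  comparison of letter counts in \<open>class_has_max\<close>.\<close>

lemma finite_total_has_max:
  assumes "finite S" "S \<noteq> {}"
    and "\<And>x y. x \<in> S \<Longrightarrow> y \<in> S \<Longrightarrow> Q x y \<or> Q y x"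
    and "\<And>x y z. x \<in> S \<Longrightarrow> y \<in> S \<Longrightarrow> z \<in> S \<Longrightarrow> Q x y \<Longrightarrow> Q y z \<Longrightarrow> Q x z"
  shows "\<exists>m\<in>S. \<forall>x\<in>S. Q x m"
  using assms
proof (induction rule: finite_ne_induct)
  case (singleton x)
  show ?case using singleton(1)[of x x] by simp
next
  case (insert x F)
  have "\<exists>m\<in>F. \<forall>y\<in>F. Q y m"
    by (rule insert.IH) (rule insert.prems; simp)+
  then obtain m where m: "m \<in> F" "\<forall>y\<in>F. Q y m" by auto
  show ?case
  proof (cases "Q x m")
    case True
    then show ?thesis using m by auto
  next
    case False
    then have "Q m x" "Q x x" using insert.prems(1)[of x m] insert.prems(1)[of x x] m by auto
    then have "Q y x" if "y \<in> insert x F" for y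
      using insert.prems(2)[of y m x] that m by auto
    then show ?thesis by auto
  qed
qed

section \<open>Toric ideals and nonstandard monomials\<close>

abbreviation toric_mon :: "'v mon mon \<Rightarrow> 'v mon" where
  "toric_mon \<equiv> lin_ext (\<lambda>a. a)"

definition nonstandard :: "'v mon set \<Rightarrow> 'v mon mon rel \<Rightarrow> 'v mon mon set" where
  "nonstandard X R = {u \<in> monomials X. \<exists>v\<in>monomials X.
     v \<noteq> u \<and> (v, u) \<in> R \<and> toric_mon v = toric_mon u}"

lemma monomial_orderD:
  assumes "monomial_order X R"
  shows "\<And>u v. (u, v) \<in> R \<Longrightarrow> u \<in> monomials X \<and> v \<in> monomials X"
    and "\<And>u. u \<in> monomials X \<Longrightarrow> (u, u) \<in> R"
    and "\<And>u v w. (u, v) \<in> R \<Longrightarrow> (v, w) \<in> R \<Longrightarrow> (u, w) \<in> R"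
    and "\<And>u v. (u, v) \<in> R \<Longrightarrow> (v, u) \<in> R \<Longrightarrow> u = v"
    and "\<And>u v. u \<in> monomials X \<Longrightarrow> v \<in> monomials X \<Longrightarrow> (u, v) \<in> R \<or> (v, u) \<in> R"
    and "\<And>u. u \<in> monomials X \<Longrightarrow> (0, u) \<in> R"
    and "\<And>u v w. (u, v) \<in> R \<Longrightarrow> w \<in> monomials X \<Longrightarrow> (u + w, v + w) \<in> R"
proof -
  have lin: "R \<subseteq> monomials X \<times> monomials X" "refl_on (monomials X) R" "trans R" "antisym R"
      "total_on (monomials X) R"
    using assms by (auto simp: monomial_order_def linear_order_on_def partial_order_on_def preorder_on_def)
  show "(u, v) \<in> R \<Longrightarrow> u \<in> monomials X \<and> v \<in> monomials X" for u v using lin by auto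
  show r: "u \<in> monomials X \<Longrightarrow> (u, u) \<in> R" for u using lin by (auto simp: refl_on_def)
  show "(u, v) \<in> R \<Longrightarrow> (v, w) \<in> R \<Longrightarrow> (u, w) \<in> R" for u v w using lin by (meson transD)
  show "(u, v) \<in> R \<Longrightarrow> (v, u) \<in> R \<Longrightarrow> u = v" for u v using lin by (meson antisymD)
  show "u \<in> monomials X \<Longrightarrow> v \<in> monomials X \<Longrightarrow> (u, v) \<in> R \<or> (v, u) \<in> R" for u v
    using lin r unfolding total_on_def by metis
  show "u \<in> monomials X \<Longrightarrow> (0, u) \<in> R" for u using assms by (simp add: monomial_order_def)
  show "(u, v) \<in> R \<Longrightarrow> w \<in> monomials X \<Longrightarrow> (u + w, v + w) \<in> R" for u v w
    using assms by (simp add: monomial_order_def)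
qed

text \<open>Multiplying a smaller element of the fibre of s by the cofactor gives a smaller element
  of the fibre of u.\<close>

lemma nonstandard_divides:
  assumes "monomial_order X R" "s \<in> nonstandard X R" "divides s u" "u \<in> monomials X"
  shows "u \<in> nonstandard X R"
proof -
  obtain v where v: "v \<in> monomials X" "v \<noteq> s" "(v, s) \<in> R" "toric_mon v = toric_mon s"
    using assms(2) by (auto simp: nonstandard_def)
  obtain w where w: "u = s + w" using assms(3) by (auto simp: divides_iff)
  have wX: "w \<in> monomials X" using assms(4) w by simp
  show ?thesis unfolding nonstandard_def
    using assms(4) v w wX monomial_orderD(7)[OF assms(1) v(3) wX]
    by (auto simp: lin_ext_add intro!: bexI[of _ "v + w"])
qed

section \<open>Membership in a toric ideal, fibre by fibre\<close>

lemma mono_poly_mult: "mono_poly (u + v) = mono_poly u * mono_poly v"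
  by (simp add: mono_poly_def mult_single)

lemma mono_poly_zero: "mono_poly 0 = 1"
  by (simp add: mono_poly_def)

lemma mono_poly_sum_const: "mono_poly (\<Sum>j<(n::nat). a) = mono_poly a ^ n"
  by (induction n) (auto simp: mono_poly_zero mono_poly_mult algebra_simps)

lemma mono_poly_sum: "mono_poly (\<Sum>x\<in>S. f x) = (\<Prod>x\<in>S. mono_poly (f x))"
  by (induction S rule: infinite_finite_induct) (auto simp: mono_poly_zero mono_poly_mult)

lemma toric_hom_eq:
  fixes f :: "('v mon, 'k::field) mpol"
  shows "toric_hom f = (\<Sum>m\<in>keys f. Poly_Mapping.single (toric_mon m) (lookup f m))"
proof -
  have "(\<Prod>x\<in>keys m. mono_poly x ^ lookup m x) = (mono_poly (toric_mon m) :: ('v, 'k) mpol)" for m :: "'v mon mon"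
    by (simp add: lin_ext_def mono_poly_sum mono_poly_sum_const)
  then show ?thesis
    unfolding toric_hom_def poly_subst_def by (simp add: mono_poly_def mult_single)
qed

text \<open>The coefficient of t in the image of f collects the coefficients of f over the fibre of
  t.\<close>

lemma in_toric_ideal_iff:
  fixes f :: "('v mon, 'k::field) mpol"
  shows "f \<in> toric_ideal K V X \<longleftrightarrow> keys f \<subseteq> monomials X \<and>
     (\<forall>t. (\<Sum>m\<in>{m \<in> keys f. toric_mon m = t}. lookup f m) = 0)"
proof -
  have "lookup (toric_hom f) t = (\<Sum>m\<in>{m \<in> keys f. toric_mon m = t}. lookup f m)" for t
    by (simp add: toric_hom_eq lookup_sum lookup_single when_def sum.If_cases Int_def)
  moreover have "toric_hom f = 0 \<longleftrightarrow> (\<forall>t. lookup (toric_hom f) t = 0)"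
    by (metis lookup_zero poly_mapping_eqI)
  ultimately show ?thesis
    by (simp add: toric_ideal_def a_kernel_def' mpoly_ring_def)
qed

lemma initial_mon_props:
  assumes "monomial_order X R" "keys f \<subseteq> monomials X" "f \<noteq> 0"
  shows "initial_mon R f \<in> keys f" and "u \<in> keys f \<Longrightarrow> (u, initial_mon R f) \<in> R"
proof -
  have "keys f \<noteq> {}" using assms(3) by simp
  then have "\<exists>m\<in>keys f. \<forall>u\<in>keys f. (u, m) \<in> R"
  proof (intro finite_total_has_max)
    show "(x, y) \<in> R \<or> (y, x) \<in> R" if "x \<in> keys f" "y \<in> keys f" for x y
      using monomial_orderD(5)[OF assms(1)] that assms(2) by blast
    show "(x, z) \<in> R" if "(x, y) \<in> R" "(y, z) \<in> R" for x y z
      using monomial_orderD(3)[OF assms(1) that] .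
  qed simp_all
  then obtain m where m: "m \<in> keys f" "\<forall>u\<in>keys f. (u, m) \<in> R" by blast
  have "initial_mon R f = m" unfolding initial_mon_def
    by (rule the_equality) (use m monomial_orderD(4)[OF assms(1)] in auto)
  then show "initial_mon R f \<in> keys f" "u \<in> keys f \<Longrightarrow> (u, initial_mon R f) \<in> R"
    using m by auto
qed

lemma initial_mon_binomial:
  assumes "monomial_order X R" "(v, u) \<in> R" "v \<noteq> u"
  shows "initial_mon R (mono_poly u - mono_poly v :: ('v, 'k::field) mpol) = u"
proof -
  have k: "keys (mono_poly u - mono_poly v :: ('v, 'k) mpol) = {u, v}"
    using assms(3) by (auto simp: in_keys_iff lookup_minus mono_poly_def lookup_single when_def split: if_splits)
  have uv: "u \<in> monomials X" "v \<in> monomials X" using monomial_orderD(1)[OF assms(1,2)] by auto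
  show ?thesis unfolding initial_mon_def k
    by (rule the_equality) (use assms uv monomial_orderD(2,4)[OF assms(1)] in auto)
qed

lemma binomial_in_toric_ideal:
  assumes "u \<in> monomials X" "v \<in> monomials X" "toric_mon u = toric_mon v" "u \<noteq> v"
  shows "(mono_poly u - mono_poly v :: ('v mon, 'k::field) mpol) \<in> toric_ideal K V X"
    and "(mono_poly u - mono_poly v :: ('v mon, 'k::field) mpol) \<noteq> 0"
    and "keys (mono_poly u - mono_poly v :: ('v mon, 'k::field) mpol) = {u, v}"
proof -
  let ?f = "mono_poly u - mono_poly v :: ('v mon, 'k) mpol"
  show k: "keys ?f = {u, v}"
    using assms(4) by (auto simp: in_keys_iff lookup_minus mono_poly_def lookup_single when_def split: if_splits)
  then show "?f \<noteq> 0" by auto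
  have "{m \<in> {u, v}. toric_mon m = t} = (if toric_mon v = t then {u, v} else {})" for t
    using assms(3) by auto
  then show "?f \<in> toric_ideal K V X"
    unfolding in_toric_ideal_iff k using assms
    by (auto simp: lookup_minus mono_poly_def lookup_single)
qed

text \<open>The coefficients of f over the fibre of its initial monomial sum to zero, while the
  coefficient of that monomial does not vanish. So f has a second, hence smaller, monomial in this
  fibre.\<close>

lemma initial_mon_nonstandard:
  assumes R: "monomial_order X R" and f: "f \<in> toric_ideal K V X" "f \<noteq> 0"
  shows "initial_mon R f \<in> nonstandard X R"
proof -
  let ?m = "initial_mon R f" and ?S = "{m \<in> keys f. toric_mon m = toric_mon (initial_mon R f)}"
  have k: "keys f \<subseteq> monomials X" and s: "(\<Sum>m\<in>?S. lookup f m) = 0"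
    using f(1) by (auto simp: in_toric_ideal_iff)
  note im = initial_mon_props[OF R k f(2)]
  have "?S \<noteq> {?m}"
  proof
    assume "?S = {?m}"
    then have "lookup f ?m = 0" using s by simp
    then show False using im(1) by (simp add: in_keys_iff)
  qed
  then obtain v where "v \<in> ?S" "v \<noteq> ?m" using im(1) by blast
  then show ?thesis using im k by (auto simp: nonstandard_def)
qed

text \<open>For the inclusion not covered by \<open>initial_mon_nonstandard\<close>, a nonstandard u
  is the initial monomial of the binomial u - v for a smaller v in its fibre.\<close>

lemma initial_mons_toric_ideal:
  assumes R: "monomial_order X R"
  shows "{mono_poly (initial_mon R f) | f. f \<in> toric_ideal (K::'k::field itself) V X \<and> f \<noteq> 0}
    = (mono_poly ` nonstandard X R :: ('v mon, 'k) mpol set)"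
proof (intro subset_antisym subsetI)
  fix g :: "('v mon, 'k) mpol" assume "g \<in> mono_poly ` nonstandard X R"
  then obtain u where g: "g = mono_poly u" and "u \<in> nonstandard X R" by auto
  then obtain v where v: "u \<in> monomials X" "v \<in> monomials X" "v \<noteq> u" "(v, u) \<in> R" "toric_mon u = toric_mon v"
    by (auto simp: nonstandard_def)
  have "u \<noteq> v" using v(3) by simp
  note binomial_in_toric_ideal(1)[OF v(1,2,5) this, where ?'k='k and K=K and V=V]
    binomial_in_toric_ideal(2)[OF v(1,2,5) this, where ?'k='k]
  moreover note initial_mon_binomial[OF R v(4,3), where ?'k='k]
  ultimately show "g \<in> {mono_poly (initial_mon R f) | f. f \<in> toric_ideal K V X \<and> f \<noteq> 0}"
    unfolding g by (metis (mono_tags, lifting) mem_Collect_eq)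
next
  fix g :: "('v mon, 'k) mpol"
  assume "g \<in> {mono_poly (initial_mon R f) | f. f \<in> toric_ideal K V X \<and> f \<noteq> 0}"
  then show "g \<in> mono_poly ` nonstandard X R" using initial_mon_nonstandard[OF R] by blast
qed

section \<open>Monomial ideals, and the translation of both properties into divisibility\<close>

lemma keys_mono_poly [simp]: "keys (mono_poly m :: ('v, 'k::field) mpol) = {m}"
  by (simp add: mono_poly_def)

lemma mono_poly_in_monomial_ideal:
  assumes S: "S \<subseteq> monomials X" and u: "u \<in> monomials X"
  shows "(mono_poly u :: ('v, 'k::field) mpol) \<in> Idl\<^bsub>mpoly_ring X\<^esub> (mono_poly ` S) \<longleftrightarrow> (\<exists>s\<in>S. divides s u)"
proof
  let ?P = "mpoly_ring X :: ('v, 'k) mpol ring"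
  interpret P: cring ?P by (rule cring_mpoly_ring)
  have gen: "(mono_poly ` S :: ('v, 'k) mpol set) \<subseteq> carrier ?P"
    using S by (auto simp: mpoly_ring_def)
  {
    assume "\<exists>s\<in>S. divides s u"
    then obtain s w where s: "s \<in> S" "u = s + w" by (auto simp: divides_iff)
    have "mono_poly s \<in> Idl\<^bsub>?P\<^esub> (mono_poly ` S)"
      using P.genideal_self[OF gen] s by auto
    moreover have "mono_poly w \<in> carrier ?P" using s u by (simp add: mpoly_ring_def)
    ultimately have "mono_poly s \<otimes>\<^bsub>?P\<^esub> mono_poly w \<in> Idl\<^bsub>?P\<^esub> (mono_poly ` S)"
      using ideal.I_r_closed[OF P.genideal_ideal[OF gen]] by blast
    then show "mono_poly u \<in> Idl\<^bsub>?P\<^esub> (mono_poly ` S)"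
      using s by (simp add: mono_poly_mult mpoly_ring_def)
  }
  \<comment> \<open>The polynomials whose monomials are all multiples of elements of
    \<open>S\<close> form an ideal, so the generated ideal contains no other monomials.\<close>
  define J :: "('v, 'k) mpol set" where
    "J = {f. keys f \<subseteq> {m \<in> monomials X. \<exists>s\<in>S. divides s m}}"
  have mult: "f * g \<in> J" if f: "f \<in> J" and g: "g \<in> carrier ?P" for f g
  proof -
    have "m \<in> monomials X \<and> (\<exists>s\<in>S. divides s m)" if m: "m \<in> keys (f * g)" for m
    proof -
      obtain a b where ab: "m = a + b" "a \<in> keys f" "b \<in> keys g"
        using keys_mult[of f g] m by auto
      then obtain s where "s \<in> S" "divides s a" "a \<in> monomials X" "b \<in> monomials X"
        using f g by (auto simp: J_def mpoly_ring_def)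
      then show ?thesis using ab divides_trans[OF _ divides_add(1)] by auto
    qed
    then show ?thesis by (auto simp: J_def)
  qed
  have add: "f + g \<in> J" if "f \<in> J" "g \<in> J" for f g
    using that keys_add[of f g] by (auto simp: J_def)
  have neg: "- f \<in> J" if "f \<in> J" for f
    using that by (auto simp: J_def)
  have "ideal J ?P"
  proof (rule idealI)
    show "ring ?P" by (rule P.ring_axioms)
    show "subgroup J (add_monoid ?P)"
    proof
      show "J \<subseteq> carrier (add_monoid ?P)" by (auto simp: J_def mpoly_ring_def)
      show "x \<otimes>\<^bsub>add_monoid ?P\<^esub> y \<in> J" if "x \<in> J" "y \<in> J" for x y
        using add that by (simp add: mpoly_ring_def)
      show "\<one>\<^bsub>add_monoid ?P\<^esub> \<in> J" by (simp add: J_def mpoly_ring_def)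
      show "inv\<^bsub>add_monoid ?P\<^esub> x \<in> J" if "x \<in> J" for x
      proof -
        have "x \<in> carrier ?P" "- x \<in> carrier ?P" using that by (auto simp: J_def mpoly_ring_def)
        then have "\<ominus>\<^bsub>?P\<^esub> x = - x"
          by (intro P.minus_equality) (auto simp: mpoly_ring_def)
        then show ?thesis using neg that by (simp add: a_inv_def)
      qed
    qed
    show "x \<otimes>\<^bsub>?P\<^esub> a \<in> J" if "a \<in> J" "x \<in> carrier ?P" for a x
      using mult[OF that] by (simp add: mpoly_ring_def mult.commute)
    show "a \<otimes>\<^bsub>?P\<^esub> x \<in> J" if "a \<in> J" "x \<in> carrier ?P" for a x
      using mult[OF that] by (simp add: mpoly_ring_def)
  qed
  moreover have "mono_poly ` S \<subseteq> J" using S by (auto simp: J_def intro: divides_refl)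
  ultimately have "Idl\<^bsub>?P\<^esub> (mono_poly ` S) \<subseteq> J" by (rule P.genideal_minimal)
  then show "mono_poly u \<in> Idl\<^bsub>?P\<^esub> (mono_poly ` S) \<Longrightarrow> \<exists>s\<in>S. divides s u"
    by (auto simp: J_def)
qed

lemma monomial_ideal_subset:
  assumes S: "S \<subseteq> monomials X" and S': "S' \<subseteq> monomials X"
    and "\<And>u. u \<in> S' \<Longrightarrow> \<exists>s\<in>S. divides s u"
  shows "Idl\<^bsub>mpoly_ring X\<^esub> (mono_poly ` S' :: ('v, 'k::field) mpol set) \<subseteq> Idl\<^bsub>mpoly_ring X\<^esub> (mono_poly ` S)"
proof -
  interpret P: cring "mpoly_ring X :: ('v, 'k) mpol ring" by (rule cring_mpoly_ring)
  show ?thesis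
  proof (rule P.genideal_minimal)
    show "ideal (Idl\<^bsub>mpoly_ring X\<^esub> (mono_poly ` S)) (mpoly_ring X :: ('v, 'k) mpol ring)"
      by (rule P.genideal_ideal) (use S in \<open>auto simp: mpoly_ring_def\<close>)
    show "mono_poly ` S' \<subseteq> Idl\<^bsub>mpoly_ring X\<^esub> (mono_poly ` S :: ('v, 'k) mpol set)"
      using assms mono_poly_in_monomial_ideal[OF S] by blast
  qed
qed

lemma nonstandard_subset: "nonstandard X R \<subseteq> monomials X"
  by (auto simp: nonstandard_def)

lemma initial_ideal_toric_ideal:
  "monomial_order X R \<Longrightarrow> initial_ideal X R (toric_ideal (K::'k::field itself) V X) =
    Idl\<^bsub>mpoly_ring X\<^esub> (mono_poly ` nonstandard X R :: ('v mon, 'k) mpol set)"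
  unfolding initial_ideal_def by (simp add: initial_mons_toric_ideal)

text \<open>The weight vector takes the value 1 on each element of \<open>X\<close>, so its value on
  \<open>toric_mon m\<close> is the degree of m.\<close>

lemma configuration_fiber_degree:
  fixes V :: "'v set"
  assumes "configuration V X" "u \<in> monomials X" "v \<in> monomials X" "toric_mon u = toric_mon v"
  shows "mon_degree u = mon_degree v"
proof -
  obtain w :: "'v \<Rightarrow> real" where w: "\<forall>a\<in>X. (\<Sum>x\<in>V. w x * real (lookup a x)) = 1"
    using assms(1) by (auto simp: configuration_def)
  define h where "h a = (\<Sum>x\<in>V. w x * real (lookup a x))" for a
  have "h (toric_mon m) = real (mon_degree m)" if "m \<in> monomials X" for m
  proof -
    have "h (toric_mon m) = lin_ext h m"
      by (rule lin_ext_hom) (auto simp: h_def lookup_add algebra_simps sum.distrib)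
    also have "\<dots> = lin_ext (\<lambda>_. 1) m"
      by (rule lin_ext_cong) (use that w in \<open>auto simp: h_def monomials_def\<close>)
    also have "\<dots> = real (lin_ext (\<lambda>_. 1) m)"
      by (subst lin_ext_hom[of real]) auto
    finally show ?thesis by (simp add: mon_degree_lin_ext)
  qed
  then show ?thesis using assms by (metis of_nat_eq_iff)
qed

text \<open>Forward, the degree of the initial monomial is bounded by that of the basis element.
  Backward, only finitely many nonstandard monomials have degree at most q; each of them minus a
  smaller monomial of its fibre becomes a basis element, and the two terms have equal degree because
  \<open>X\<close> is a configuration.\<close>

lemma has_binomial_groebner_basis_iff:
  assumes conf: "configuration V X"
  shows "has_binomial_groebner_basis X (toric_ideal (K::'k::field itself) V X) q \<longleftrightarrow>
    (\<exists>R. monomial_order X R \<and>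
      (\<forall>u\<in>nonstandard X R. \<exists>s\<in>nonstandard X R. divides s u \<and> mon_degree s \<le> q))"
proof
  assume "has_binomial_groebner_basis X (toric_ideal K V X) q"
  then obtain R G where R: "monomial_order X R" and G: "groebner_basis X R (toric_ideal K V X) G"
    and deg: "\<forall>g\<in>G. total_degree g \<le> q"
    by (auto simp: has_binomial_groebner_basis_def)
  define S where "S = initial_mon R ` G"
  have sub: "G \<subseteq> toric_ideal K V X" "0 \<notin> G" using G by (auto simp: groebner_basis_def)
  have S: "S \<subseteq> nonstandard X R"
    unfolding S_def using sub initial_mon_nonstandard[OF R] by blast
  have "{mono_poly (initial_mon R g) | g. g \<in> G} = (mono_poly ` S :: ('a mon, 'k) mpol set)"
    by (auto simp: S_def)
  then have I: "Idl\<^bsub>mpoly_ring X\<^esub> (mono_poly ` S :: ('a mon, 'k) mpol set) =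
      Idl\<^bsub>mpoly_ring X\<^esub> (mono_poly ` nonstandard X R)"
    using G initial_ideal_toric_ideal[OF R, where ?'k='k and K=K and V=V] by (simp add: groebner_basis_def)
  have "\<exists>s\<in>nonstandard X R. divides s u \<and> mon_degree s \<le> q" if u: "u \<in> nonstandard X R" for u
  proof -
    have uX: "u \<in> monomials X" using u nonstandard_subset by blast
    have "(mono_poly u :: ('a mon, 'k) mpol) \<in> Idl\<^bsub>mpoly_ring X\<^esub> (mono_poly ` nonstandard X R)"
      using mono_poly_in_monomial_ideal[OF nonstandard_subset uX] u divides_refl by blast
    then obtain s where s: "s \<in> S" "divides s u"
      using mono_poly_in_monomial_ideal[OF _ uX, where ?'k='k, of S] S nonstandard_subset[of X R] I by blast
    then obtain g where g: "g \<in> G" "s = initial_mon R g" by (auto simp: S_def)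
    have "g \<in> toric_ideal K V X" using sub(1) g(1) by (rule subsetD)
    then have "keys g \<subseteq> monomials X" by (simp add: in_toric_ideal_iff)
    then have "s \<in> keys g" using g initial_mon_props(1)[OF R] sub(2) by metis
    then have "mon_degree s \<le> total_degree g" unfolding total_degree_def by (intro Max_ge) auto
    then show ?thesis using s S deg g by force
  qed
  then show "\<exists>R. monomial_order X R \<and>
      (\<forall>u\<in>nonstandard X R. \<exists>s\<in>nonstandard X R. divides s u \<and> mon_degree s \<le> q)" using R by blast
next
  assume "\<exists>R. monomial_order X R \<and>
      (\<forall>u\<in>nonstandard X R. \<exists>s\<in>nonstandard X R. divides s u \<and> mon_degree s \<le> q)"
  then obtain R where R: "monomial_order X R"
    and gen: "\<And>u. u \<in> nonstandard X R \<Longrightarrow> \<exists>s\<in>nonstandard X R. divides s u \<and> mon_degree s \<le> q" by auto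
  define S where "S = {s \<in> nonstandard X R. mon_degree s \<le> q}"
  have fin: "finite S"
  proof (rule finite_subset)
    show "S \<subseteq> {m \<in> monomials X. mon_degree m \<le> q}"
      using nonstandard_subset[of X R] by (auto simp: S_def)
    show "finite {m \<in> monomials X. mon_degree m \<le> q}"
      by (rule finite_monomials_bounded) (use conf in \<open>simp add: configuration_def\<close>)
  qed
  have "\<forall>s\<in>S. \<exists>v\<in>monomials X. v \<noteq> s \<and> (v, s) \<in> R \<and> toric_mon v = toric_mon s"
    by (auto simp: S_def nonstandard_def)
  then obtain v where v: "\<And>s. s \<in> S \<Longrightarrow> v s \<in> monomials X"
    "\<And>s. s \<in> S \<Longrightarrow> v s \<noteq> s" "\<And>s. s \<in> S \<Longrightarrow> (v s, s) \<in> R" "\<And>s. s \<in> S \<Longrightarrow> toric_mon (v s) = toric_mon s"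
    by metis
  have SX: "s \<in> monomials X" if "s \<in> S" for s using that nonstandard_subset by (auto simp: S_def)
  define b where "b s = (mono_poly s - mono_poly (v s) :: ('a mon, 'k) mpol)" for s
  have bI: "b s \<in> toric_ideal K V X" "b s \<noteq> 0" "keys (b s) = {s, v s}" "initial_mon R (b s) = s"
    if "s \<in> S" for s
    using binomial_in_toric_ideal(1)[OF SX[OF that] v(1)[OF that] v(4)[OF that, symmetric] v(2)[OF that, symmetric],
        where ?'k='k and K=K and V=V]
      binomial_in_toric_ideal(2,3)[OF SX[OF that] v(1)[OF that] v(4)[OF that, symmetric] v(2)[OF that, symmetric],
        where ?'k='k]
      initial_mon_binomial[OF R v(3)[OF that] v(2)[OF that]]
    by (auto simp: b_def)
  have "{mono_poly (initial_mon R g) | g. g \<in> b ` S} = (mono_poly ` S :: ('a mon, 'k) mpol set)"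
    using bI(4) by force
  moreover have "Idl\<^bsub>mpoly_ring X\<^esub> (mono_poly ` S :: ('a mon, 'k) mpol set) =
      Idl\<^bsub>mpoly_ring X\<^esub> (mono_poly ` nonstandard X R)"
  proof (rule subset_antisym; rule monomial_ideal_subset)
    show "\<exists>s\<in>nonstandard X R. divides s u" if "u \<in> S" for u
      using that by (auto simp: S_def intro: divides_refl)
    show "\<exists>s\<in>S. divides s u" if "u \<in> nonstandard X R" for u
      using gen[OF that] by (auto simp: S_def)
  qed (use SX nonstandard_subset in auto)
  ultimately have "groebner_basis X R (toric_ideal K V X) (b ` S)"
    unfolding groebner_basis_def using fin bI(1,2) initial_ideal_toric_ideal[OF R, where ?'k='k and K=K and V=V]
    by auto
  moreover have "is_binomial g \<and> total_degree g \<le> q" if g: "g \<in> b ` S" for g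
  proof -
    obtain s where s: "s \<in> S" "g = b s" using g by auto
    have "mon_degree (v s) = mon_degree s"
      using configuration_fiber_degree[OF conf v(1)[OF s(1)] SX[OF s(1)] v(4)[OF s(1)]] .
    moreover have "mon_degree s \<le> q" using s by (simp add: S_def)
    ultimately show ?thesis
      using s bI(3)[OF s(1)] by (auto simp: is_binomial_def b_def total_degree_def)
  qed
  ultimately show "has_binomial_groebner_basis X (toric_ideal K V X) q"
    unfolding has_binomial_groebner_basis_def using R by blast
qed

lemma has_squarefree_initial_ideal_iff:
  "has_squarefree_initial_ideal X (toric_ideal (K::'k::field itself) V X) \<longleftrightarrow>
    (\<exists>R. monomial_order X R \<and>
      (\<forall>u\<in>nonstandard X R. \<exists>s\<in>nonstandard X R. divides s u \<and> squarefree_mon s))"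
proof
  assume "has_squarefree_initial_ideal X (toric_ideal K V X)"
  then obtain R S where R: "monomial_order X R" and S: "S \<subseteq> monomials X" "\<forall>m\<in>S. squarefree_mon m"
    and I: "Idl\<^bsub>mpoly_ring X\<^esub> (mono_poly ` nonstandard X R) = Idl\<^bsub>mpoly_ring X\<^esub> (mono_poly ` S :: ('a mon, 'k) mpol set)"
    unfolding has_squarefree_initial_ideal_def squarefree_ideal_def
    using initial_ideal_toric_ideal by metis
  have iff: "(\<exists>s\<in>S. divides s u) \<longleftrightarrow> (\<exists>s\<in>nonstandard X R. divides s u)" if "u \<in> monomials X" for u
    using mono_poly_in_monomial_ideal[OF S(1) that, where ?'k='k]
      mono_poly_in_monomial_ideal[OF nonstandard_subset that, where ?'k='k] I by blast
  have "\<exists>s\<in>nonstandard X R. divides s u \<and> squarefree_mon s" if u: "u \<in> nonstandard X R" for u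
  proof -
    obtain s where s: "s \<in> S" "divides s u" using iff[of u] u nonstandard_subset divides_refl by blast
    \<comment> \<open>A generator in \<open>S\<close> is a multiple of a nonstandard monomial, hence
      nonstandard itself.\<close>
    then obtain s' where "s' \<in> nonstandard X R" "divides s' s"
      using iff[of s] S divides_refl by blast
    then have "s \<in> nonstandard X R" using nonstandard_divides[OF R] s S by blast
    then show ?thesis using s S by blast
  qed
  then show "\<exists>R. monomial_order X R \<and>
      (\<forall>u\<in>nonstandard X R. \<exists>s\<in>nonstandard X R. divides s u \<and> squarefree_mon s)" using R by blast
next
  assume "\<exists>R. monomial_order X R \<and>
      (\<forall>u\<in>nonstandard X R. \<exists>s\<in>nonstandard X R. divides s u \<and> squarefree_mon s)"
  then obtain R where R: "monomial_order X R"
    and gen: "\<And>u. u \<in> nonstandard X R \<Longrightarrow> \<exists>s\<in>nonstandard X R. divides s u \<and> squarefree_mon s" by auto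
  define S where "S = {s \<in> nonstandard X R. squarefree_mon s}"
  have "Idl\<^bsub>mpoly_ring X\<^esub> (mono_poly ` S :: ('a mon, 'k) mpol set) =
      Idl\<^bsub>mpoly_ring X\<^esub> (mono_poly ` nonstandard X R)"
  proof (rule subset_antisym; rule monomial_ideal_subset)
    show "\<exists>s\<in>nonstandard X R. divides s u" if "u \<in> S" for u
      using that by (auto simp: S_def intro: divides_refl)
    show "\<exists>s\<in>S. divides s u" if "u \<in> nonstandard X R" for u
      using gen[OF that] by (auto simp: S_def)
  qed (use nonstandard_subset in \<open>auto simp: S_def\<close>)
  moreover have "S \<subseteq> monomials X" "\<forall>m\<in>S. squarefree_mon m"
    using nonstandard_subset by (auto simp: S_def)
  ultimately show "has_squarefree_initial_ideal X (toric_ideal K V X)"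
    unfolding has_squarefree_initial_ideal_def squarefree_ideal_def
    using R initial_ideal_toric_ideal[OF R, where ?'k='k and K=K and V=V] by metis
qed


section \<open>Lexicographic refinements of monomial orders\<close>

lemma zero_le_mon: "0 \<le> m" for m :: "'v::linorder mon"
proof (rule ccontr)
  assume "\<not> 0 \<le> m"
  then have "m < 0" by simp
  then show False by transfer (auto simp: less_fun_def)
qed

lemma monomial_order_std:
  "monomial_order X {(u, v). u \<in> monomials X \<and> v \<in> monomials X \<and> u \<le> (v :: 'v::linorder mon)}"
  unfolding monomial_order_def linear_order_on_def partial_order_on_def preorder_on_def
  by (auto simp: refl_on_def trans_def antisym_def total_on_def zero_le_mon add_right_mono)

text \<open>The properties of a monomial order for a target that need not consist of monomials; it
  is applied to monomial orders and to the natural numbers. Reflexivity is contained in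
  totality.\<close>

definition additive_order :: "'m::cancel_comm_monoid_add set \<Rightarrow> 'm rel \<Rightarrow> bool" where
  "additive_order Y Q \<longleftrightarrow>
     (\<forall>x\<in>Y. \<forall>y\<in>Y. (x, y) \<in> Q \<or> (y, x) \<in> Q) \<and>
     (\<forall>x\<in>Y. \<forall>y\<in>Y. (x, y) \<in> Q \<longrightarrow> (y, x) \<in> Q \<longrightarrow> x = y) \<and>
     (\<forall>x\<in>Y. \<forall>y\<in>Y. \<forall>z\<in>Y. (x, y) \<in> Q \<longrightarrow> (y, z) \<in> Q \<longrightarrow> (x, z) \<in> Q) \<and>
     (\<forall>x\<in>Y. (0, x) \<in> Q) \<and>
     (\<forall>x\<in>Y. \<forall>y\<in>Y. \<forall>z\<in>Y. (x, y) \<in> Q \<longrightarrow> (x + z, y + z) \<in> Q)"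

lemma additive_order_monomial_order:
  "monomial_order X R \<Longrightarrow> additive_order (monomials X) R"
  unfolding additive_order_def
  using monomial_orderD(3-6)[of X R] monomial_orderD(7)[of X R] by meson

lemma additive_order_nat: "additive_order UNIV {(x, y :: nat). x \<le> y}"
  by (auto simp: additive_order_def)

definition lex_order :: "'v set \<Rightarrow> ('v mon \<Rightarrow> 'm) \<Rightarrow> 'm rel \<Rightarrow> 'v mon rel \<Rightarrow> 'v mon rel" where
  "lex_order X f Q R = {(u, v). u \<in> monomials X \<and> v \<in> monomials X \<and>
     (if f u = f v then (u, v) \<in> R else (f u, f v) \<in> Q)}"

text \<open>Cancellation in the target keeps distinct values of f distinct after multiplication by
  w, so multiplication does not change which component decides the comparison.\<close>

lemma monomial_order_lex_order:
  assumes R: "monomial_order X R" and Q: "additive_order Y Q"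
    and f: "\<And>u. u \<in> monomials X \<Longrightarrow> f u \<in> Y" "f 0 = 0" "\<And>u v. f (u + v) = f u + f v"
  shows "monomial_order X (lex_order X f Q R)"
proof -
  note RD = monomial_orderD[OF R]
  have Q1: "x \<in> Y \<Longrightarrow> y \<in> Y \<Longrightarrow> (x, y) \<in> Q \<or> (y, x) \<in> Q"
   and Q2: "x \<in> Y \<Longrightarrow> y \<in> Y \<Longrightarrow> (x, y) \<in> Q \<Longrightarrow> (y, x) \<in> Q \<Longrightarrow> x = y"
   and Q3: "x \<in> Y \<Longrightarrow> y \<in> Y \<Longrightarrow> z \<in> Y \<Longrightarrow> (x, y) \<in> Q \<Longrightarrow> (y, z) \<in> Q \<Longrightarrow> (x, z) \<in> Q"
   and Q4: "x \<in> Y \<Longrightarrow> (0, x) \<in> Q"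
   and Q5: "x \<in> Y \<Longrightarrow> y \<in> Y \<Longrightarrow> z \<in> Y \<Longrightarrow> (x, y) \<in> Q \<Longrightarrow> (x + z, y + z) \<in> Q" for x y z
    using Q unfolding additive_order_def by blast+
  let ?L = "lex_order X f Q R"
  have "trans ?L"
  proof (rule transI)
    fix u v w assume uv: "(u, v) \<in> ?L" and vw: "(v, w) \<in> ?L"
    have m: "u \<in> monomials X" "v \<in> monomials X" "w \<in> monomials X"
      using uv vw by (auto simp: lex_order_def)
    show "(u, w) \<in> ?L"
    proof (cases "f u = f v \<or> f v = f w")
      case True
      then show ?thesis using uv vw RD(3) by (auto simp: lex_order_def split: if_splits)
    next
      case False
      then have "(f u, f v) \<in> Q" "(f v, f w) \<in> Q" using uv vw by (auto simp: lex_order_def)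
      moreover from this have "f u \<noteq> f w" using Q2[OF f(1)[OF m(1)] f(1)[OF m(2)]] False by auto
      ultimately show ?thesis using Q3[OF f(1)[OF m(1)] f(1)[OF m(2)] f(1)[OF m(3)]] m
        by (auto simp: lex_order_def)
    qed
  qed
  moreover have "antisym ?L"
    by (rule antisymI) (auto simp: lex_order_def RD(4) f(1) Q2 split: if_splits)
  moreover have "total_on (monomials X) ?L"
  proof (rule total_onI)
    fix u v assume m: "u \<in> monomials X" "v \<in> monomials X"
    then show "(u, v) \<in> ?L \<or> (v, u) \<in> ?L"
      using RD(5)[OF m] Q1[OF f(1)[OF m(1)] f(1)[OF m(2)]] by (auto simp: lex_order_def)
  qed
  moreover have "refl_on (monomials X) ?L" "?L \<subseteq> monomials X \<times> monomials X"
    by (auto simp: refl_on_def lex_order_def RD(2))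
  moreover have "(0, u) \<in> ?L" if "u \<in> monomials X" for u
    using that RD(6) Q4 f by (auto simp: lex_order_def)
  moreover have "(u + w, v + w) \<in> ?L" if "(u, v) \<in> ?L" "w \<in> monomials X" for u v w
    using that RD(7) Q5 f by (auto simp: lex_order_def split: if_splits)
  ultimately show ?thesis
    unfolding monomial_order_def linear_order_on_def partial_order_on_def preorder_on_def by blast
qed

section \<open>Gluing monomial orders over disjoint sets of variables\<close>

abbreviation divisor_generated :: "('v mon \<Rightarrow> bool) \<Rightarrow> 'v mon set \<Rightarrow> bool" where
  "divisor_generated P M \<equiv> \<forall>u\<in>M. \<exists>s\<in>M. divides s u \<and> P s"

text \<open>Sets the variables outside \<open>X\<close> to 1. Writing it with \<open>lin_ext\<close>
  makes it additive and lets it be composed with \<open>toric_mon\<close> through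
  \<open>lin_ext_lin_ext\<close>.\<close>

definition restr :: "'a set \<Rightarrow> 'a mon \<Rightarrow> 'a mon" where
  "restr X m = lin_ext (\<lambda>x. if x \<in> X then Poly_Mapping.single x 1 else 0) m"

lemma lookup_restr: "lookup (restr X m) y = (if y \<in> X then lookup m y else 0)"
proof -
  have "lookup (restr X m) y = (\<Sum>x\<in>keys m. if x = y then (if y \<in> X then lookup m y else 0) else 0)"
    unfolding restr_def lookup_lin_ext lin_ext_nat
    by (rule sum.cong) (auto simp: lookup_single when_def)
  then show ?thesis by (auto simp: in_keys_iff)
qed

lemma restr_add: "restr X (m + m') = restr X m + restr X m'"
  by (simp add: restr_def lin_ext_add)

lemma restr_zero [simp]: "restr X 0 = 0"
  by (simp add: restr_def)

lemma keys_restr: "keys (restr X m) = keys m \<inter> X"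
  by (auto simp: in_keys_iff lookup_restr split: if_splits)

lemma restr_monomials [simp]: "restr X m \<in> monomials X"
  by (simp add: monomials_def keys_restr)

lemma divides_restr: "divides (restr X m) m"
  by (simp add: divides_def lookup_restr)

lemma restr_id: "m \<in> monomials X \<Longrightarrow> restr X m = m"
  by (rule poly_mapping_eqI) (auto simp: lookup_restr monomials_def in_keys_iff)

lemma restr_disjoint: "m \<in> monomials X \<Longrightarrow> X \<inter> Y = {} \<Longrightarrow> restr Y m = 0"
  by (rule poly_mapping_eqI) (auto simp: lookup_restr monomials_def in_keys_iff)

lemma restr_toric_mon:
  assumes "X \<subseteq> monomials V" "X' \<subseteq> monomials V'" "V \<inter> V' = {}" "0 \<notin> X" "u \<in> monomials (X \<union> X')"
  shows "restr V (toric_mon u) = toric_mon (restr X u)"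
proof -
  have "restr V (toric_mon u) = lin_ext (restr V) u"
    by (rule lin_ext_hom) (simp_all add: restr_add)
  also have "\<dots> = lin_ext (\<lambda>x. if x \<in> X then x else 0) u"
  proof (rule lin_ext_cong)
    fix x assume "x \<in> keys u"
    then have x: "x \<in> X \<or> x \<in> X'" using assms(5) by (auto simp: monomials_def)
    show "restr V x = (if x \<in> X then x else 0)"
      using x assms restr_id[of x V] restr_disjoint[of x V' V] by auto
  qed
  also have "\<dots> = toric_mon (restr X u)"
    unfolding restr_def lin_ext_lin_ext by (rule lin_ext_cong) simp
  finally show ?thesis .
qed

text \<open>Since the variables are disjoint, a fibre over the union is a product of a fibre over
  \<open>X1\<close> and a fibre over \<open>X2\<close>. A smaller element of the fibre of u is
  smaller in the first component that changes, and this component of u is already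
  nonstandard.\<close>

lemma divisor_generated_union:
  fixes X1 X2 :: "'v::linorder mon set"
  assumes X: "X1 \<subseteq> monomials V1" "X2 \<subseteq> monomials V2" "V1 \<inter> V2 = {}" "0 \<notin> X1" "0 \<notin> X2"
    and R1: "monomial_order X1 R1" "divisor_generated P (nonstandard X1 R1)"
    and R2: "monomial_order X2 R2" "divisor_generated P (nonstandard X2 R2)"
  shows "\<exists>R. monomial_order (X1 \<union> X2) R \<and> divisor_generated P (nonstandard (X1 \<union> X2) R)"
proof -
  let ?X = "X1 \<union> X2"
  define S where "S = {(u, v). u \<in> monomials ?X \<and> v \<in> monomials ?X \<and> u \<le> v}"
  define L2 where "L2 = lex_order ?X (restr X2) R2 S"
  define L where "L = lex_order ?X (restr X1) R1 L2"
  have S: "monomial_order ?X S" unfolding S_def by (rule monomial_order_std)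
  have L2: "monomial_order ?X L2" unfolding L2_def
    by (rule monomial_order_lex_order[OF S additive_order_monomial_order[OF R2(1)]]) (auto simp: restr_add)
  have L: "monomial_order ?X L" unfolding L_def
    by (rule monomial_order_lex_order[OF L2 additive_order_monomial_order[OF R1(1)]]) (auto simp: restr_add)
  have disj: "X1 \<inter> X2 = {}"
  proof -
    have "x = 0" if "x \<in> X1" "x \<in> X2" for x
    proof -
      have "keys x \<subseteq> V1 \<inter> V2" using that X(1,2) by (auto simp: monomials_def)
      then have "keys x = {}" using X(3) by simp
      then show ?thesis by simp
    qed
    then show ?thesis using X(4) by blast
  qed
  have sub: "monomials X1 \<subseteq> monomials ?X" "monomials X2 \<subseteq> monomials ?X"
    by (auto simp: monomials_def)
  have fib: "toric_mon (restr X1 u) = toric_mon (restr X1 v)" "toric_mon (restr X2 u) = toric_mon (restr X2 v)"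
    if "toric_mon u = toric_mon v" "u \<in> monomials ?X" "v \<in> monomials ?X" for u v
    using restr_toric_mon[OF X(1,2,3,4)] restr_toric_mon[OF X(2,1) _ X(5)] X(3) that
    by (metis Int_commute Un_commute)+
  have N1: "s \<in> nonstandard ?X L" if s: "s \<in> nonstandard X1 R1" for s
  proof -
    obtain v where v: "s \<in> monomials X1" "v \<in> monomials X1" "v \<noteq> s" "(v, s) \<in> R1" "toric_mon v = toric_mon s"
      using s by (auto simp: nonstandard_def)
    then have "(v, s) \<in> L" using sub by (auto simp: L_def lex_order_def restr_id)
    then show ?thesis unfolding nonstandard_def using v sub by blast
  qed
  have N2: "s \<in> nonstandard ?X L" if s: "s \<in> nonstandard X2 R2" for s
  proof -
    obtain v where v: "s \<in> monomials X2" "v \<in> monomials X2" "v \<noteq> s" "(v, s) \<in> R2" "toric_mon v = toric_mon s"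
      using s by (auto simp: nonstandard_def)
    \<comment> \<open>Monomials over \<open>X2\<close> have trivial part over \<open>X1\<close>, so
      \<open>L\<close> compares them by \<open>R2\<close>.\<close>
    moreover have "restr X1 v = 0" "restr X1 s = 0"
      using v disj by (auto intro: restr_disjoint)
    ultimately have "(v, s) \<in> L" using sub by (auto simp: L_def L2_def lex_order_def restr_id)
    then show ?thesis unfolding nonstandard_def using v sub by blast
  qed
  have "\<exists>s\<in>nonstandard ?X L. divides s u \<and> P s" if u: "u \<in> nonstandard ?X L" for u
  proof -
    obtain v where v: "u \<in> monomials ?X" "v \<in> monomials ?X" "v \<noteq> u" "(v, u) \<in> L" "toric_mon v = toric_mon u"
      using u by (auto simp: nonstandard_def)
    note fib = fib[OF v(5,2,1)]
    show ?thesis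
    proof (cases "restr X1 v = restr X1 u")
      case False
      then have "(restr X1 v, restr X1 u) \<in> R1" using v(4) by (auto simp: L_def lex_order_def)
      then have "restr X1 u \<in> nonstandard X1 R1"
        using False fib(1) unfolding nonstandard_def by auto
      then obtain s where "s \<in> nonstandard X1 R1" "divides s (restr X1 u)" "P s" using R1(2) by blast
      then show ?thesis using N1 divides_trans[OF _ divides_restr] by blast
    next
      case True
      then have "(v, u) \<in> L2" using v(4) by (auto simp: L_def lex_order_def)
      have "restr X2 v \<noteq> restr X2 u"
      proof
        assume e: "restr X2 v = restr X2 u"
        have "lookup v x = lookup u x" for x
        proof (cases "x \<in> ?X")
          case in_X: True
          then show ?thesis using True e by (metis UnE lookup_restr)
        next
          case False
          then have "x \<notin> keys u" "x \<notin> keys v" using v(1,2) by (auto simp: monomials_def)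
          then show ?thesis by (simp add: in_keys_iff)
        qed
        then show False using v(3) poly_mapping_eqI by blast
      qed
      moreover from this have "(restr X2 v, restr X2 u) \<in> R2"
        using \<open>(v, u) \<in> L2\<close> by (auto simp: L2_def lex_order_def)
      ultimately have "restr X2 u \<in> nonstandard X2 R2"
        using fib(2) unfolding nonstandard_def by auto
      then obtain s where "s \<in> nonstandard X2 R2" "divides s (restr X2 u)" "P s" using R2(2) by blast
      then show ?thesis using N2 divides_trans[OF _ divides_restr] by blast
    qed
  qed
  then show ?thesis using L by blast
qed

lemma nonstandard_empty: "monomial_order {} R \<Longrightarrow> nonstandard {} R = {}"
  by (auto simp: nonstandard_def monomials_def)

lemma divisor_generated_UN:
  fixes X :: "'i \<Rightarrow> 'v::linorder mon set"
  assumes "finite T"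
    and "\<And>i. i \<in> T \<Longrightarrow> X i \<subseteq> monomials (V i)" "\<And>i. i \<in> T \<Longrightarrow> 0 \<notin> X i"
    and "\<And>i j. i \<in> T \<Longrightarrow> j \<in> T \<Longrightarrow> i \<noteq> j \<Longrightarrow> V i \<inter> V j = {}"
    and "\<And>i. i \<in> T \<Longrightarrow> \<exists>R. monomial_order (X i) R \<and> divisor_generated P (nonstandard (X i) R)"
  shows "\<exists>R. monomial_order (\<Union>i\<in>T. X i) R \<and> divisor_generated P (nonstandard (\<Union>i\<in>T. X i) R)"
  using assms
proof (induction T rule: finite_induct)
  case empty
  show ?case using monomial_order_std[of "{} :: 'v mon set"] nonstandard_empty by fastforce
next
  case (insert i T)
  obtain R where R: "monomial_order (\<Union>i\<in>T. X i) R" "divisor_generated P (nonstandard (\<Union>i\<in>T. X i) R)"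
    using insert.IH[OF insert.prems(1) insert.prems(2) insert.prems(3) insert.prems(4)] by auto
  obtain R' where R': "monomial_order (X i) R'" "divisor_generated P (nonstandard (X i) R')"
    using insert.prems(4)[of i] by auto
  have "X i \<subseteq> monomials (V i)" "0 \<notin> X i" "0 \<notin> (\<Union>i\<in>T. X i)"
    using insert.prems(1,2) by auto
  moreover have "(\<Union>i\<in>T. X i) \<subseteq> monomials (\<Union>i\<in>T. V i)"
    using insert.prems(1) unfolding monomials_def by blast
  moreover have "V i \<inter> (\<Union>i\<in>T. V i) = {}"
  proof -
    have "V i \<inter> V j = {}" if "j \<in> T" for j
      using insert.prems(3)[of i j] insert.hyps that by auto
    then show ?thesis by blast
  qed
  ultimately show ?case
    using divisor_generated_union[of "X i" "V i" "\<Union>i\<in>T. X i" "\<Union>i\<in>T. V i", OF _ _ _ _ _ R' R]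
    by simp
qed


text \<open>The degree bound makes the fibre finite, so it has a least element, and that element is
  standard.\<close>

lemma exists_standard:
  assumes R: "monomial_order X R" and "finite X" and u: "u \<in> monomials X"
    and deg: "\<And>v. v \<in> monomials X \<Longrightarrow> toric_mon v = toric_mon u \<Longrightarrow> mon_degree v \<le> mon_degree u"
  shows "\<exists>v\<in>monomials X. v \<notin> nonstandard X R \<and> toric_mon v = toric_mon u \<and> (v, u) \<in> R"
proof -
  let ?S = "{v \<in> monomials X. toric_mon v = toric_mon u}"
  have "\<exists>m\<in>?S. \<forall>x\<in>?S. (m, x) \<in> R"
  proof (rule finite_total_has_max)
    show "finite ?S"
      by (rule finite_subset[OF _ finite_monomials_bounded[OF \<open>finite X\<close>, of "mon_degree u"]])
        (use deg in blast)
    show "?S \<noteq> {}" using u by blast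
  qed (use monomial_orderD(3,5)[OF R] in blast)+
  then obtain m where m: "m \<in> monomials X" "toric_mon m = toric_mon u" "\<forall>x\<in>?S. (m, x) \<in> R" by blast
  have "m \<notin> nonstandard X R"
    unfolding nonstandard_def using monomial_orderD(4)[OF R] m by auto
  then show ?thesis using m u by blast
qed

lemma standard_unique:
  assumes R: "monomial_order X R" and "u \<in> monomials X" "v \<in> monomials X"
    and "u \<notin> nonstandard X R" "v \<notin> nonstandard X R" "toric_mon u = toric_mon v"
  shows "u = v"
  using assms monomial_orderD(5)[OF R assms(2,3)] unfolding nonstandard_def by auto

section \<open>Pulling divisors back along an additive map\<close>

lemma lin_ext_monomials:
  "(\<And>x. x \<in> keys m \<Longrightarrow> \<tau> x \<in> monomials Y) \<Longrightarrow> lin_ext \<tau> m \<in> monomials Y"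
  by (induction m rule: mon_induct) (auto simp: lin_ext_add keys_add_nat)

lemma lin_ext_const_nat: "lin_ext (\<lambda>_. c) m = mon_degree m * c" for c :: nat
  by (simp add: lin_ext_nat mon_degree_def sum_distrib_right)

lemma in_keys_lin_ext:
  "y \<in> keys (lin_ext \<tau> m) \<longleftrightarrow> (\<exists>x\<in>keys m. y \<in> keys (\<tau> x))" for \<tau> :: "'a \<Rightarrow> 'b mon"
  by (auto simp: in_keys_iff lookup_lin_ext lin_ext_nat)

lemma mon_degree_single_Suc0 [simp]: "mon_degree (Poly_Mapping.single x (Suc 0)) = 1"
  using mon_degree_single[of x] by simp

text \<open>\<open>Some k\<close> is the condition of part (a) with degree bound k,
  \<open>None\<close> that of part (b). One predicate lets both parts share the
  construction.\<close>

definition restricted_mon :: "nat option \<Rightarrow> 'v mon \<Rightarrow> bool" where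
  "restricted_mon q s = (case q of None \<Rightarrow> squarefree_mon s | Some k \<Rightarrow> mon_degree s \<le> k)"

text \<open>Each variable of s is supplied by some variable of u. Choosing such an x for one of them
  and cancelling from s all that \<open>\<tau> x\<close> supplies lowers the degree of s, so at most
  \<open>mon_degree s\<close> choices are made.\<close>

lemma divisor_of_small_degree:
  "divides s (lin_ext \<tau> u) \<Longrightarrow> \<exists>u'. divides u' u \<and> divides s (lin_ext \<tau> u') \<and> mon_degree u' \<le> mon_degree s"
  for \<tau> :: "'a \<Rightarrow> 'b mon"
proof (induction "mon_degree s" arbitrary: s u rule: less_induct)
  case less
  show ?case
  proof (cases "s = 0")
    case True
    then show ?thesis by (intro exI[of _ 0]) (simp add: divides_def)
  next
    case False
    then obtain y where y: "y \<in> keys s" by (metis keys_eq_empty ex_in_conv)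
    have "lookup s y \<le> lookup (lin_ext \<tau> u) y" using less.prems by (simp add: divides_def)
    then have "y \<in> keys (lin_ext \<tau> u)" using y by (simp add: in_keys_iff)
    then obtain x where x: "x \<in> keys u" "y \<in> keys (\<tau> x)" by (auto simp: in_keys_lin_ext)
    define u1 where "u1 = u - Poly_Mapping.single x 1"
    have u: "u = u1 + Poly_Mapping.single x 1" unfolding u1_def by (rule sub_single_add[OF x(1)])
    \<comment> \<open>Subtraction truncates: this is s divided by its greatest common divisor with
      \<open>\<tau> x\<close>.\<close>
    define s1 where "s1 = s - \<tau> x"
    have s: "lookup s1 z = lookup s z - lookup (\<tau> x) z" for z by (simp add: s1_def lookup_minus)
    have "divides s1 s" by (simp add: divides_def s)
    then have "mon_degree s = mon_degree s1 + mon_degree (s - s1)"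
      by (metis divides_diff mon_degree_add)
    moreover have "0 < lookup s y" "0 < lookup (\<tau> x) y" using x y by (simp_all add: in_keys_iff)
    then have "lookup (s - s1) y \<noteq> 0" by (simp add: s lookup_minus)
    then have "s - s1 \<noteq> 0" by (metis lookup_zero)
    then have "mon_degree (s - s1) \<noteq> 0" by simp
    ultimately have d: "mon_degree s1 < mon_degree s" by linarith
    have "divides s1 (lin_ext \<tau> u1)"
      using less.prems unfolding divides_def u lin_ext_add s by (simp add: lookup_add le_diff_conv)
    then obtain u' where u': "divides u' u1" "divides s1 (lin_ext \<tau> u')" "mon_degree u' \<le> mon_degree s1"
      using less.hyps[OF d] by auto
    let ?u = "u' + Poly_Mapping.single x 1"
    have "divides ?u u" using u'(1) by (simp add: divides_def u lookup_add)
    moreover have "divides s (lin_ext \<tau> ?u)"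
      using u'(2) by (simp add: divides_def s lin_ext_add lookup_add le_diff_conv)
    moreover have "mon_degree ?u \<le> mon_degree s" using u'(3) d by (simp add: mon_degree_add)
    ultimately show ?thesis by blast
  qed
qed

text \<open>A squarefree s divides a monomial as soon as its variables occur there, so u may be
  replaced by the product of its distinct variables.\<close>

lemma divisor_of_squarefree:
  fixes \<tau> :: "'a \<Rightarrow> 'b mon"
  assumes "divides s (lin_ext \<tau> u)" "squarefree_mon s"
  shows "\<exists>u'. divides u' u \<and> divides s (lin_ext \<tau> u') \<and> squarefree_mon u'"
proof -
  define u' where "u' = (\<Sum>x\<in>keys u. Poly_Mapping.single x (1::nat))"
  have l: "lookup u' x = (if x \<in> keys u then 1 else 0)" for x
    by (simp add: u'_def lookup_sum lookup_single when_def)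
  have k: "keys u' = keys u" by (auto simp: in_keys_iff l split: if_splits)
  have "lookup s y \<le> lookup (lin_ext \<tau> u') y" for y
  proof (cases "y \<in> keys s")
    case True
    have "lookup s y \<le> lookup (lin_ext \<tau> u) y" using assms(1) by (simp add: divides_def)
    then have "y \<in> keys (lin_ext \<tau> u)" using True by (simp add: in_keys_iff)
    then have "y \<in> keys (lin_ext \<tau> u')" by (simp add: in_keys_lin_ext k)
    then have "1 \<le> lookup (lin_ext \<tau> u') y" by (simp add: in_keys_iff Suc_leI)
    moreover have "lookup s y \<le> 1" using assms(2) by (simp add: squarefree_mon_def)
    ultimately show ?thesis by linarith
  qed (simp add: in_keys_iff)
  moreover have "divides u' u" by (auto simp: divides_def l in_keys_iff Suc_leI)
  moreover have "squarefree_mon u'" by (simp add: squarefree_mon_def l)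
  ultimately show ?thesis by (auto simp: divides_def)
qed

lemma restricted_divisor:
  assumes "divides s (lin_ext \<tau> u)" "restricted_mon q s"
  shows "\<exists>u'. divides u' u \<and> divides s (lin_ext \<tau> u') \<and> restricted_mon q u'"
proof (cases q)
  case None
  then show ?thesis using divisor_of_squarefree assms by (simp add: restricted_mon_def)
next
  case (Some k)
  then show ?thesis
    using divisor_of_small_degree[OF assms(1)] assms(2) by (auto simp: restricted_mon_def intro: le_trans)
qed

text \<open>A product of two distinct variables is squarefree and has degree 2, which is where the
  lower bound on k comes from.\<close>

lemma restricted_mon_pair:
  assumes "n \<noteq> n'" "\<And>k. q = Some k \<Longrightarrow> 2 \<le> k"
  shows "restricted_mon q (Poly_Mapping.single n 1 + Poly_Mapping.single n' 1)"
  using assms by (auto simp: restricted_mon_def squarefree_mon_def lookup_add lookup_single when_def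
      mon_degree_add split: option.splits)

section \<open>Down-sets and balanced splittings\<close>

text \<open>The initial segments of the linear order on \<open>C\<close>. They form a chain, and
  their differences are the intervals on which letters will be counted.\<close>

definition down_sets :: "'c::linorder set \<Rightarrow> 'c set set" where
  "down_sets C = {D. D \<subseteq> C \<and> (\<forall>x\<in>D. \<forall>y\<in>C. y \<le> x \<longrightarrow> y \<in> D)}"

definition count_in :: "'c set \<Rightarrow> 'c mon \<Rightarrow> nat" where
  "count_in D m = (\<Sum>b\<in>D. lookup m b)"

lemma count_in_add: "count_in D (m + m') = count_in D m + count_in D m'"
  by (simp add: count_in_def lookup_add sum.distrib)

lemma count_in_zero [simp]: "count_in D 0 = 0"
  by (simp add: count_in_def)

lemma count_in_empty [simp]: "count_in {} m = 0"
  by (simp add: count_in_def)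

lemma count_in_single: "finite D \<Longrightarrow> count_in D (Poly_Mapping.single b (Suc 0)) = (if b \<in> D then 1 else 0)"
  by (simp add: count_in_def lookup_single when_def)

lemma count_in_lin_ext: "count_in D (lin_ext \<tau> m) = lin_ext (\<lambda>x. count_in D (\<tau> x)) m"
  by (rule lin_ext_hom) (auto simp: count_in_add)

lemma count_in_diff: "finite D \<Longrightarrow> E \<subseteq> D \<Longrightarrow> count_in D m = count_in (D - E) m + count_in E m"
  by (simp add: count_in_def sum.subset_diff)

lemma count_in_eq_0: "finite D \<Longrightarrow> count_in D m = 0 \<longleftrightarrow> D \<inter> keys m = {}"
  by (auto simp: count_in_def in_keys_iff)

lemma down_sets_subset: "D \<in> down_sets C \<Longrightarrow> D \<subseteq> C"
  by (simp add: down_sets_def)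

lemma finite_down_sets: "finite C \<Longrightarrow> finite (down_sets C)"
  by (rule finite_subset[of _ "Pow C"]) (auto simp: down_sets_def)

lemma empty_down_set: "{} \<in> down_sets C"
  by (simp add: down_sets_def)

lemma down_sets_chain: "D \<in> down_sets C \<Longrightarrow> E \<in> down_sets C \<Longrightarrow> D \<subseteq> E \<or> E \<subseteq> D"
  unfolding down_sets_def by (smt (verit) linear mem_Collect_eq subset_eq)

lemma principal_down_sets: "{x \<in> C. x \<le> b} \<in> down_sets C" "{x \<in> C. x < b} \<in> down_sets C"
  by (auto simp: down_sets_def)

text \<open>The exponent of b is the count on \<open>{x \<in> C. x \<le> b}\<close> minus the count
  on \<open>{x \<in> C. x < b}\<close>.\<close>

lemma down_set_counts_determine:
  assumes "finite C" "m \<in> monomials C" "m' \<in> monomials C"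
    and "\<And>D. D \<in> down_sets C \<Longrightarrow> count_in D m = count_in D m'"
  shows "m = m'"
proof (rule poly_mapping_eqI)
  fix b
  show "lookup m b = lookup m' b"
  proof (cases "b \<in> C")
    case True
    have "{x \<in> C. x \<le> b} - {x \<in> C. x < b} = {b}" using True by auto
    moreover have "count_in {b} w = lookup w b" for w by (simp add: count_in_def)
    moreover have "finite {x \<in> C. x \<le> b}" "{x \<in> C. x < b} \<subseteq> {x \<in> C. x \<le> b}"
      using assms(1) by auto
    ultimately have *: "count_in {x \<in> C. x \<le> b} w = lookup w b + count_in {x \<in> C. x < b} w" for w
      using count_in_diff by metis
    show ?thesis
      using *[of m] *[of m'] assms(4)[OF principal_down_sets(1)] assms(4)[OF principal_down_sets(2)]
      by (metis add_right_cancel)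
  next
    case False
    then have "b \<notin> keys m" "b \<notin> keys m'" using assms(2,3) by (auto simp: monomials_def)
    then show ?thesis by (simp add: in_keys_iff)
  qed
qed

text \<open>The letters are dealt out in increasing order to m and m' in turn, m being served first.
  The induction takes away the largest letter, which is dealt last.\<close>

lemma balanced_split:
  assumes "finite C" "\<gamma> \<in> monomials C"
  shows "\<exists>m m'. \<gamma> = m + m' \<and>
    (\<forall>D\<in>down_sets C. count_in D m' \<le> count_in D m \<and> count_in D m \<le> count_in D m' + 1)"
  using assms(2)
proof (induction "mon_degree \<gamma>" arbitrary: \<gamma> rule: less_induct)
  case less
  show ?case
  proof (cases "\<gamma> = 0")
    case True
    then show ?thesis by (intro exI[of _ 0]) auto
  next
    case False
    define b where "b = Max (keys \<gamma>)"
    have b: "b \<in> keys \<gamma>" "\<And>x. x \<in> keys \<gamma> \<Longrightarrow> x \<le> b"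
      using False by (auto simp: b_def intro!: Max_in)
    define \<delta> where "\<delta> = \<gamma> - Poly_Mapping.single b 1"
    have \<gamma>: "\<gamma> = \<delta> + Poly_Mapping.single b 1" unfolding \<delta>_def by (rule sub_single_add[OF b(1)])
    have "mon_degree \<delta> < mon_degree \<gamma>" by (simp add: \<gamma> mon_degree_add)
    moreover have "\<delta> \<in> monomials C" using less.prems \<gamma> by simp
    ultimately obtain m m' where mm: "\<delta> = m + m'"
      and bal: "\<And>D. D \<in> down_sets C \<Longrightarrow> count_in D m' \<le> count_in D m \<and> count_in D m \<le> count_in D m' + 1"
      using less.hyps by metis
    have C_down: "C \<in> down_sets C" by (simp add: down_sets_def)
    \<comment> \<open>An initial segment containing the largest letter contains all letters, so the
      total counts alone decide which part receives b.\<close>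
    have full: "count_in D m = count_in C m" "count_in D m' = count_in C m'"
      if D: "D \<in> down_sets C" "b \<in> D" for D
    proof -
      have "(C - D) \<inter> keys \<gamma> = {}"
        using D b(2) by (auto simp: down_sets_def)
      then have "count_in (C - D) m = 0" "count_in (C - D) m' = 0"
        using assms(1) by (auto simp: count_in_eq_0 \<gamma> mm keys_add_nat)
      then show "count_in D m = count_in C m" "count_in D m' = count_in C m'"
        using count_in_diff[OF assms(1) down_sets_subset[OF D(1)]] by auto
    qed
    have fin: "finite D" if "D \<in> down_sets C" for D
      using that down_sets_subset assms(1) finite_subset by blast
    note cs = count_in_add count_in_single
    show ?thesis
    proof (cases "count_in C m = count_in C m'")
      case True
      have "count_in D m' \<le> count_in D (m + Poly_Mapping.single b 1) \<and>
          count_in D (m + Poly_Mapping.single b 1) \<le> count_in D m' + 1" if D: "D \<in> down_sets C" for D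
        using full[OF D] bal[OF D] fin[OF D] True by (auto simp: cs)
      moreover have "\<gamma> = (m + Poly_Mapping.single b 1) + m'" by (simp add: \<gamma> mm algebra_simps)
      ultimately show ?thesis by blast
    next
      case False
      then have "count_in C m = count_in C m' + 1" using bal[OF C_down] by auto
      then have "count_in D (m' + Poly_Mapping.single b 1) \<le> count_in D m \<and>
          count_in D m \<le> count_in D (m' + Poly_Mapping.single b 1) + 1" if D: "D \<in> down_sets C" for D
        using full[OF D] bal[OF D] fin[OF D] by (auto simp: cs)
      moreover have "\<gamma> = m + (m' + Poly_Mapping.single b 1)" by (simp add: \<gamma> mm algebra_simps)
      ultimately show ?thesis by blast
    qed
  qed
qed


section \<open>The monomial order of the nested configuration\<close>

lemma nat_rearrangement:
  fixes r r' q q' :: nat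
  assumes "r < r'" "q < q'"
  shows "r * q' + r' * q < r * q + r' * q'"
proof -
  obtain k where k: "k > 0" "r' = r + k" using less_imp_add_positive[OF assms(1)] by auto
  obtain l where l: "l > 0" "q' = q + l" using less_imp_add_positive[OF assms(2)] by auto
  show ?thesis using k(1) l(1) by (simp add: k(2) l(2) algebra_simps)
qed

text \<open>Here \<open>idx b\<close> is the block of the letter b. Antimonotonicity makes the
  blocks intervals of \<open>C\<close>; \<open>fiber_idx\<close> makes the number of letters from
  each block an invariant of their product.\<close>

locale nested_orders =
  fixes A :: "'t::linorder mon set" and C :: "'b::linorder mon set" and idx :: "'b mon \<Rightarrow> 't"
    and RA :: "'t mon mon rel" and RC :: "'b mon mon rel"
  assumes finite_A: "finite A" and finite_C: "finite C"
    and RA: "monomial_order A RA" and RC: "monomial_order C RC"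
    and idx_antimono: "\<And>b b'. b \<in> C \<Longrightarrow> b' \<in> C \<Longrightarrow> b \<le> b' \<Longrightarrow> idx b' \<le> idx b"
    and fiber_idx: "\<And>\<beta> \<beta>'. \<beta> \<in> monomials C \<Longrightarrow> \<beta>' \<in> monomials C \<Longrightarrow> toric_mon \<beta> = toric_mon \<beta>' \<Longrightarrow>
      lin_ext (\<lambda>b. Poly_Mapping.single (idx b) (1::nat)) \<beta> = lin_ext (\<lambda>b. Poly_Mapping.single (idx b) 1) \<beta>'"
begin

definition type_of :: "'b mon mon \<Rightarrow> 't mon" where
  "type_of \<beta> = lin_ext (\<lambda>b. Poly_Mapping.single (idx b) 1) \<beta>"

text \<open>\<open>nested_divisor_generated\<close> identifies this set with
  \<open>nested_configuration r A B\<close>; there a factorisation is an indexed family, here it is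
  a monomial over \<open>C\<close>.\<close>

definition N :: "'b mon set" where
  "N = toric_mon ` {\<beta> \<in> monomials C. type_of \<beta> \<in> A}"

text \<open>An element of \<open>N\<close> may be a product of letters in several ways, but its
  standard expression is unique by \<open>standard_unique\<close>, so the choice can be computed in
  \<open>std_expr_toric_mon\<close>.\<close>

definition std_expr :: "'b mon \<Rightarrow> 'b mon mon" where
  "std_expr n = (SOME \<beta>. \<beta> \<in> monomials C \<and> \<beta> \<notin> nonstandard C RC \<and> toric_mon \<beta> = n)"

definition shape :: "'b mon \<Rightarrow> 't mon" where
  "shape n = type_of (std_expr n)"

definition shapes :: "'b mon mon \<Rightarrow> 't mon mon" where
  "shapes u = lin_ext (\<lambda>n. Poly_Mapping.single (shape n) 1) u"

definition letters :: "'b mon mon \<Rightarrow> 'b mon mon" where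
  "letters u = lin_ext std_expr u"

section \<open>Types, shapes and letters\<close>

lemma type_of_add: "type_of (\<beta> + \<beta>') = type_of \<beta> + type_of \<beta>'"
  by (simp add: type_of_def lin_ext_add)

lemma type_of_zero [simp]: "type_of 0 = 0"
  by (simp add: type_of_def)

lemma type_of_single [simp]: "type_of (Poly_Mapping.single b (Suc 0)) = Poly_Mapping.single (idx b) 1"
  by (simp add: type_of_def)

lemma fiber_type:
  "\<beta> \<in> monomials C \<Longrightarrow> \<beta>' \<in> monomials C \<Longrightarrow> toric_mon \<beta> = toric_mon \<beta>' \<Longrightarrow> type_of \<beta> = type_of \<beta>'"
  unfolding type_of_def by (rule fiber_idx)

lemma mon_degree_type_of: "mon_degree (type_of \<beta>) = mon_degree \<beta>"
  by (simp add: type_of_def mon_degree_lin_ext_eq lin_ext_const_nat)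

lemma exists_standard_C:
  assumes "\<beta> \<in> monomials C"
  shows "\<exists>\<beta>'\<in>monomials C. \<beta>' \<notin> nonstandard C RC \<and> toric_mon \<beta>' = toric_mon \<beta>"
proof -
  have "mon_degree v \<le> mon_degree \<beta>" if "v \<in> monomials C" "toric_mon v = toric_mon \<beta>" for v
    using fiber_type[OF that(1) assms that(2)] mon_degree_type_of by (metis order_refl)
  then show ?thesis using exists_standard[OF RC finite_C assms] by blast
qed

lemma std_expr:
  assumes "n \<in> N"
  shows "std_expr n \<in> monomials C" "std_expr n \<notin> nonstandard C RC" "toric_mon (std_expr n) = n"
    "shape n \<in> A"
proof -
  obtain \<beta> where \<beta>: "\<beta> \<in> monomials C" "type_of \<beta> \<in> A" "n = toric_mon \<beta>"
    using assms by (auto simp: N_def)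
  have "\<exists>\<beta>. \<beta> \<in> monomials C \<and> \<beta> \<notin> nonstandard C RC \<and> toric_mon \<beta> = n"
    using exists_standard_C[OF \<beta>(1)] \<beta>(3) by blast
  from someI_ex[OF this] show *: "std_expr n \<in> monomials C" "std_expr n \<notin> nonstandard C RC"
    "toric_mon (std_expr n) = n"
    unfolding std_expr_def by auto
  then show "shape n \<in> A" unfolding shape_def using fiber_type[OF *(1) \<beta>(1)] \<beta> by simp
qed

lemma std_expr_toric_mon:
  assumes "\<beta> \<in> monomials C" "\<beta> \<notin> nonstandard C RC" "type_of \<beta> \<in> A"
  shows "toric_mon \<beta> \<in> N" "std_expr (toric_mon \<beta>) = \<beta>" "shape (toric_mon \<beta>) = type_of \<beta>"
proof -
  show N: "toric_mon \<beta> \<in> N" using assms by (auto simp: N_def)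
  show "std_expr (toric_mon \<beta>) = \<beta>"
    by (rule standard_unique[OF RC]) (use std_expr[OF N] assms in auto)
  then show "shape (toric_mon \<beta>) = type_of \<beta>" by (simp add: shape_def)
qed

lemma shapes_add: "shapes (u + v) = shapes u + shapes v"
  by (simp add: shapes_def lin_ext_add)

lemma letters_add: "letters (u + v) = letters u + letters v"
  by (simp add: letters_def lin_ext_add)

lemma shapes_zero [simp]: "shapes 0 = 0" and letters_zero [simp]: "letters 0 = 0"
  by (simp_all add: shapes_def letters_def)

lemma shapes_single [simp]: "shapes (Poly_Mapping.single n (Suc 0)) = Poly_Mapping.single (shape n) 1"
  by (simp add: shapes_def)

lemma letters_single [simp]: "letters (Poly_Mapping.single n (Suc 0)) = std_expr n"
  by (simp add: letters_def)

lemma shapes_monomials: "u \<in> monomials N \<Longrightarrow> shapes u \<in> monomials A"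
  unfolding shapes_def by (rule lin_ext_monomials) (use std_expr(4) in \<open>auto simp: monomials_def\<close>)

lemma letters_monomials: "u \<in> monomials N \<Longrightarrow> letters u \<in> monomials C"
  unfolding letters_def
proof (rule lin_ext_monomials)
  fix n assume "u \<in> monomials N" "n \<in> keys u"
  then have "n \<in> N" by (auto simp: monomials_def)
  then show "std_expr n \<in> monomials C" by (rule std_expr(1))
qed

lemma toric_mon_letters: "u \<in> monomials N \<Longrightarrow> toric_mon (letters u) = toric_mon u"
  unfolding letters_def lin_ext_lin_ext
  by (rule lin_ext_cong) (use std_expr(3) in \<open>auto simp: monomials_def\<close>)

lemma toric_mon_shapes: "toric_mon (shapes u) = type_of (letters u)"
proof -
  have "type_of (letters u) = lin_ext shape u"
    unfolding letters_def shape_def by (rule lin_ext_hom) (simp_all add: type_of_add)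
  then show ?thesis by (simp add: shapes_def lin_ext_lin_ext)
qed

lemma mon_degree_shapes: "mon_degree (shapes u) = mon_degree u"
  by (simp add: shapes_def mon_degree_lin_ext_eq lin_ext_const_nat)

text \<open>Each variable i of a is matched with a letter of block i in \<beta>, one at a
  time.\<close>

lemma divisor_of_type:
  "divides a (type_of \<beta>) \<Longrightarrow> \<exists>\<beta>1. divides \<beta>1 \<beta> \<and> type_of \<beta>1 = a"
proof (induction a arbitrary: \<beta> rule: mon_induct)
  case zero
  then show ?case by (intro exI[of _ 0]) (simp add: divides_def)
next
  case (add m i)
  have "1 \<le> lookup (type_of \<beta>) i"
    using add.prems by (auto simp: divides_def lookup_add lookup_single when_def dest: spec[of _ i])
  then have "i \<in> keys (type_of \<beta>)" by (simp add: in_keys_iff)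
  then obtain b where b: "b \<in> keys \<beta>" "idx b = i"
    by (auto simp: type_of_def in_keys_lin_ext)
  define \<beta>' where "\<beta>' = \<beta> - Poly_Mapping.single b 1"
  have \<beta>: "\<beta> = \<beta>' + Poly_Mapping.single b 1" unfolding \<beta>'_def by (rule sub_single_add[OF b(1)])
  have "divides m (type_of \<beta>')"
    using add.prems b(2) by (simp add: \<beta> type_of_add divides_def lookup_add)
  then obtain \<beta>1 where "divides \<beta>1 \<beta>'" "type_of \<beta>1 = m" using add.IH by blast
  then show ?case
    by (intro exI[of _ "\<beta>1 + Poly_Mapping.single b 1"])
      (simp add: \<beta> b(2) type_of_add divides_def lookup_add)
qed

lemma standard_divisor:
  "\<beta> + \<beta>' \<in> monomials C \<Longrightarrow> \<beta> + \<beta>' \<notin> nonstandard C RC \<Longrightarrow> \<beta> \<notin> nonstandard C RC"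
  using nonstandard_divides[OF RC] divides_add(1) by blast

text \<open>The letters of \<beta> are dealt out to the shapes in \<alpha>, with any choice inside
  the blocks. Each portion divides the standard \<beta>, so it is standard and therefore the
  standard expression of an element of \<open>N\<close>; this is why v has exactly the prescribed
  shapes and letters.\<close>

lemma realize:
  assumes "\<alpha> \<in> monomials A" "\<beta> \<in> monomials C" "\<beta> \<notin> nonstandard C RC" "toric_mon \<alpha> = type_of \<beta>"
  shows "\<exists>v\<in>monomials N. shapes v = \<alpha> \<and> letters v = \<beta>"
  using assms
proof (induction \<alpha> arbitrary: \<beta> rule: mon_induct)
  case zero
  then have "mon_degree \<beta> = 0" using mon_degree_type_of[of \<beta>] by simp
  then show ?case by (intro bexI[of _ 0]) auto
next
  case (add m a)
  have a: "a \<in> A" "m \<in> monomials A" using add.prems(1) by auto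
  have t: "type_of \<beta> = toric_mon m + a" using add.prems(4) by (simp add: lin_ext_add)
  then have "divides a (type_of \<beta>)" by simp
  then obtain \<beta>1 where \<beta>1: "divides \<beta>1 \<beta>" "type_of \<beta>1 = a" using divisor_of_type by blast
  then obtain \<beta>2 where \<beta>: "\<beta> = \<beta>1 + \<beta>2" by (auto simp: divides_iff)
  have m: "\<beta>1 \<in> monomials C" "\<beta>2 \<in> monomials C" using add.prems(2) \<beta> by auto
  have s: "\<beta>1 \<notin> nonstandard C RC" "\<beta>2 \<notin> nonstandard C RC"
    using standard_divisor[of \<beta>1 \<beta>2] standard_divisor[of \<beta>2 \<beta>1] add.prems(2,3) \<beta>
    by (auto simp: add.commute)
  have "toric_mon m = type_of \<beta>2" using t \<beta>1(2) \<beta> by (simp add: type_of_add add.commute)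
  then obtain v where v: "v \<in> monomials N" "shapes v = m" "letters v = \<beta>2"
    using add.IH[OF a(2) m(2) s(2)] by blast
  note x = std_expr_toric_mon[OF m(1) s(1)]
  show ?case
    by (intro bexI[of _ "v + Poly_Mapping.single (toric_mon \<beta>1) 1"])
      (use v x \<beta>1(2) a(1) \<beta> in \<open>simp_all add: shapes_add letters_add add.commute\<close>)
qed

text \<open>The rank of the shape grows with the shape, while the number of letters from b upwards
  falls as b grows. By rearrangement, the sum of the products is least when larger shapes carry
  larger letters.\<close>

definition weight1 :: "'b mon \<Rightarrow> nat" where
  "weight1 n = card {a \<in> A. a \<le> shape n} * lin_ext (\<lambda>b. card {b' \<in> C. b \<le> b'}) (std_expr n)"

text \<open>Squares with a fixed sum of bases are least when the bases are balanced; summing over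
  all pairs \<open>(D, E)\<close> penalises imbalance on every interval at once.\<close>

definition weight2 :: "'b mon \<Rightarrow> nat" where
  "weight2 n = (\<Sum>(D, E)\<in>down_sets C \<times> down_sets C. (count_in (D - E) (std_expr n))\<^sup>2)"

text \<open>Exchanging letters within a block keeps shapes and letters, so the weights come after
  both. Balancing two variables of equal shape keeps \<open>weight1\<close> too, so
  \<open>weight2\<close> comes after it.\<close>

definition RN :: "'b mon mon rel" where
  "RN = lex_order N shapes RA (lex_order N letters RC
     (lex_order N (lin_ext weight1) {(x, y). x \<le> y} (lex_order N (lin_ext weight2) {(x, y). x \<le> y}
     {(u, v). u \<in> monomials N \<and> v \<in> monomials N \<and> u \<le> v})))"

section \<open>Sources of nonstandard monomials: shapes, letters and pairs of variables\<close>

lemma monomial_order_RN: "monomial_order N RN"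
  unfolding RN_def
  by (intro monomial_order_lex_order[OF _ additive_order_nat]
      monomial_order_lex_order[OF _ additive_order_monomial_order[OF RA]]
      monomial_order_lex_order[OF _ additive_order_monomial_order[OF RC]] monomial_order_std)
    (auto simp: shapes_add letters_add lin_ext_add intro: shapes_monomials letters_monomials)

text \<open>A smaller \<alpha> in the fibre of the shapes can be combined with a standard monomial
  in the fibre of the letters, because the type is constant on that fibre. Shapes are compared
  first, so the change of letters does no harm.\<close>

lemma nonstandard_shapes:
  assumes u: "u \<in> monomials N" and ns: "shapes u \<in> nonstandard A RA"
  shows "u \<in> nonstandard N RN"
proof -
  obtain \<alpha> where \<alpha>: "\<alpha> \<in> monomials A" "\<alpha> \<noteq> shapes u" "(\<alpha>, shapes u) \<in> RA" "toric_mon \<alpha> = toric_mon (shapes u)"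
    using ns by (auto simp: nonstandard_def)
  obtain \<beta> where \<beta>: "\<beta> \<in> monomials C" "\<beta> \<notin> nonstandard C RC" "toric_mon \<beta> = toric_mon (letters u)"
    using exists_standard_C[OF letters_monomials[OF u]] by blast
  have "toric_mon \<alpha> = type_of \<beta>"
    using \<alpha>(4) fiber_type[OF \<beta>(1) letters_monomials[OF u] \<beta>(3)] toric_mon_shapes by simp
  then obtain v where v: "v \<in> monomials N" "shapes v = \<alpha>" "letters v = \<beta>"
    using realize[OF \<alpha>(1) \<beta>(1,2)] by blast
  moreover have "toric_mon v = toric_mon u"
    using toric_mon_letters[OF v(1)] toric_mon_letters[OF u] v(3) \<beta>(3) by simp
  moreover have "(v, u) \<in> RN" using u v \<alpha>(2,3) by (simp add: RN_def lex_order_def)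
  moreover have "v \<noteq> u" using v(2) \<alpha>(2) by auto
  ultimately show ?thesis using u unfolding nonstandard_def by blast
qed

text \<open>Passing to the standard letters keeps the type, so the shapes can stay as they are and
  \<open>RC\<close> decides.\<close>

lemma nonstandard_letters:
  assumes u: "u \<in> monomials N" and ns: "letters u \<in> nonstandard C RC"
  shows "u \<in> nonstandard N RN"
proof -
  note lu = letters_monomials[OF u]
  obtain \<beta> where \<beta>: "\<beta> \<in> monomials C" "\<beta> \<notin> nonstandard C RC" "toric_mon \<beta> = toric_mon (letters u)"
      "(\<beta>, letters u) \<in> RC"
    using exists_standard[OF RC finite_C lu] fiber_type[OF _ lu] mon_degree_type_of by (metis order_refl)
  have "\<beta> \<noteq> letters u" using \<beta>(2) ns by auto
  have "toric_mon (shapes u) = type_of \<beta>"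
    using fiber_type[OF \<beta>(1) lu \<beta>(3)] toric_mon_shapes by simp
  then obtain v where v: "v \<in> monomials N" "shapes v = shapes u" "letters v = \<beta>"
    using realize[OF shapes_monomials[OF u] \<beta>(1,2)] by blast
  moreover have "toric_mon v = toric_mon u"
    using toric_mon_letters[OF v(1)] toric_mon_letters[OF u] v(3) \<beta>(3) by simp
  moreover have "(v, u) \<in> RN" using u v \<beta>(4) \<open>\<beta> \<noteq> letters u\<close> by (simp add: RN_def lex_order_def)
  moreover have "v \<noteq> u" using v(3) \<open>\<beta> \<noteq> letters u\<close> by auto
  ultimately show ?thesis using u unfolding nonstandard_def by blast
qed

text \<open>Exchanging b and b' keeps both shapes, as the two letters lie in one block, and keeps
  the product of all letters. That product is standard, so both new portions are standard
  expressions. The comparison falls to \<open>weight1\<close>, which drops by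
  \<open>nat_rearrangement\<close>.\<close>

lemma nonstandard_unsorted_pair:
  assumes N: "n \<in> N" "n' \<in> N" and std: "std_expr n + std_expr n' \<notin> nonstandard C RC"
    and sh: "shape n < shape n'" and b: "b \<in> keys (std_expr n)" "b' \<in> keys (std_expr n')" "idx b = idx b'" "b' < b"
  shows "Poly_Mapping.single n 1 + Poly_Mapping.single n' 1 \<in> nonstandard N RN"
proof -
  define c where "c = std_expr n - Poly_Mapping.single b 1"
  define c' where "c' = std_expr n' - Poly_Mapping.single b' 1"
  have c: "std_expr n = c + Poly_Mapping.single b 1" unfolding c_def by (rule sub_single_add[OF b(1)])
  have c': "std_expr n' = c' + Poly_Mapping.single b' 1" unfolding c'_def by (rule sub_single_add[OF b(2)])
  define m where "m = c + Poly_Mapping.single b' 1"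
  define m' where "m' = c' + Poly_Mapping.single b 1"
  have sum: "m + m' = std_expr n + std_expr n'" by (simp add: m_def m'_def c c' algebra_simps)
  have mon: "std_expr n + std_expr n' \<in> monomials C" using std_expr(1) N by simp
  then have mC: "m \<in> monomials C" "m' \<in> monomials C" using sum monomials_add by metis+
  have ms: "m \<notin> nonstandard C RC" "m' \<notin> nonstandard C RC"
    using standard_divisor[of m m'] standard_divisor[of m' m] mC std sum by (auto simp: add.commute)
  have mt: "type_of m = shape n" "type_of m' = shape n'"
    using b(3) by (simp_all add: shape_def c c' m_def m'_def type_of_add)
  note x = std_expr_toric_mon[OF mC(1) ms(1)] and x' = std_expr_toric_mon[OF mC(2) ms(2)]
  let ?u = "Poly_Mapping.single n 1 + Poly_Mapping.single n' (1::nat)"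
  let ?v = "Poly_Mapping.single (toric_mon m) 1 + Poly_Mapping.single (toric_mon m') (1::nat)"
  have uN: "?u \<in> monomials N" using N by simp
  have vN: "?v \<in> monomials N" using x(1) x'(1) mt std_expr(4) N by simp
  have e: "std_expr (toric_mon m) = m" "std_expr (toric_mon m') = m'"
    "shape (toric_mon m) = shape n" "shape (toric_mon m') = shape n'"
    using x(2,3) x'(2,3) mt std_expr(4) N by auto
  have sv: "shapes ?v = shapes ?u" by (simp add: shapes_add e)
  have lv: "letters ?v = letters ?u" using sum by (simp add: letters_add e)
  have bC: "b \<in> C" "b' \<in> C" using b(1,2) std_expr(1) N by (auto simp: monomials_def)
  let ?r = "card {a \<in> A. a \<le> shape n}" and ?r' = "card {a \<in> A. a \<le> shape n'}"
  let ?q = "\<lambda>b. card {b' \<in> C. b \<le> b'}"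
  have "{a \<in> A. a \<le> shape n} \<subseteq> {a \<in> A. a \<le> shape n'}" using sh by auto
  moreover have "shape n' \<in> {a \<in> A. a \<le> shape n'}" "shape n' \<notin> {a \<in> A. a \<le> shape n}"
    using sh std_expr(4) N by auto
  ultimately have "{a \<in> A. a \<le> shape n} \<subset> {a \<in> A. a \<le> shape n'}" by blast
  then have r: "?r < ?r'" using finite_A by (intro psubset_card_mono) simp_all
  have "{c \<in> C. b \<le> c} \<subseteq> {c \<in> C. b' \<le> c}" using b(4) by auto
  moreover have "b' \<in> {c \<in> C. b' \<le> c}" "b' \<notin> {c \<in> C. b \<le> c}" using b(4) bC by auto
  ultimately have "{c \<in> C. b \<le> c} \<subset> {c \<in> C. b' \<le> c}" by blast
  then have q: "?q b < ?q b'" using finite_C by (intro psubset_card_mono) simp_all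
  have "?r * ?q b' + ?r' * ?q b < ?r * ?q b + ?r' * ?q b'"
    by (rule nat_rearrangement[OF r q])
  moreover have "lin_ext weight1 ?v = ?r * lin_ext ?q m + ?r' * lin_ext ?q m'"
    by (simp add: lin_ext_add weight1_def e)
  moreover have "lin_ext weight1 ?u = ?r * lin_ext ?q (std_expr n) + ?r' * lin_ext ?q (std_expr n')"
    by (simp add: lin_ext_add weight1_def)
  moreover have "lin_ext ?q m = lin_ext ?q c + ?q b'" "lin_ext ?q m' = lin_ext ?q c' + ?q b"
    "lin_ext ?q (std_expr n) = lin_ext ?q c + ?q b" "lin_ext ?q (std_expr n') = lin_ext ?q c' + ?q b'"
    by (simp_all add: m_def m'_def c c' lin_ext_add)
  ultimately have w: "lin_ext weight1 ?v < lin_ext weight1 ?u"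
    by (simp add: distrib_left)
  have "(?v, ?u) \<in> RN" unfolding RN_def using uN vN sv lv w by (simp add: lex_order_def)
  moreover have "?v \<noteq> ?u" using w by (metis less_irrefl)
  moreover have "toric_mon ?v = toric_mon ?u"
    using toric_mon_letters[OF vN] toric_mon_letters[OF uN] lv by simp
  ultimately show ?thesis using uN vN unfolding nonstandard_def by blast
qed

text \<open>The difference of these two initial segments is block i; this is how balanced splittings
  control the type.\<close>

lemma down_set_idx: "{b \<in> C. i \<le> idx b} \<in> down_sets C" "{b \<in> C. i < idx b} \<in> down_sets C"
proof -
  have "i \<le> idx y" if "i \<le> idx x" "x \<in> C" "y \<in> C" "y \<le> x" for x y
    using that idx_antimono[of y x] by simp
  then show "{b \<in> C. i \<le> idx b} \<in> down_sets C" by (auto simp: down_sets_def)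
  have "i < idx y" if "i < idx x" "x \<in> C" "y \<in> C" "y \<le> x" for x y
    using that idx_antimono[of y x] by simp
  then show "{b \<in> C. i < idx b} \<in> down_sets C" by (auto simp: down_sets_def)
qed

lemma lookup_type_of:
  assumes "\<beta> \<in> monomials C"
  shows "lookup (type_of \<beta>) i = count_in {b \<in> C. idx b = i} \<beta>"
proof -
  have "lookup (type_of \<beta>) i = (\<Sum>b\<in>keys \<beta>. if idx b = i then lookup \<beta> b else 0)"
    unfolding type_of_def lookup_lin_ext lin_ext_nat
    by (rule sum.cong) (auto simp: lookup_single when_def)
  also have "\<dots> = (\<Sum>b\<in>C. if idx b = i then lookup \<beta> b else 0)"
    by (rule sum.mono_neutral_left) (use assms finite_C in \<open>auto simp: monomials_def in_keys_iff\<close>)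
  also have "\<dots> = count_in {b \<in> C. idx b = i} \<beta>"
    unfolding count_in_def using finite_C by (simp add: sum.If_cases Int_def)
  finally show ?thesis .
qed

end

text \<open>By 2 (a^2 + b^2) = (a + b)^2 + (a - b)^2 only the differences matter. They have the same
  parity, so a difference of absolute value at most 1 is the least possible.\<close>

lemma sum_squares_balanced:
  fixes x y x' y' :: nat
  assumes "x + y = x' + y'" "x' \<le> y' + 1" "y' \<le> x' + 1"
  shows "x'\<^sup>2 + y'\<^sup>2 \<le> x\<^sup>2 + y\<^sup>2" and "y + 1 < x \<Longrightarrow> x'\<^sup>2 + y'\<^sup>2 < x\<^sup>2 + y\<^sup>2"
proof -
  define d where "d = int x - int y"
  define d' where "d' = int x' - int y'"
  have s: "int x + int y = int x' + int y'" using assms(1) by linarith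
  have e: "2 * ((int a)\<^sup>2 + (int b)\<^sup>2) = (int a + int b)\<^sup>2 + (int a - int b)\<^sup>2" for a b
    by (simp add: power2_eq_square algebra_simps)
  have par: "even (d - d')" using s unfolding d_def d'_def by presburger
  have d': "\<bar>d'\<bar> \<le> 1" using assms(2,3) by (simp add: d'_def)
  have "\<bar>d'\<bar> \<le> \<bar>d\<bar>" using par d' by presburger
  then have "d'\<^sup>2 \<le> d\<^sup>2" by (simp add: abs_le_square_iff)
  then have "int (x'\<^sup>2 + y'\<^sup>2) \<le> int (x\<^sup>2 + y\<^sup>2)"
    using e[of x y] e[of x' y'] s by (simp add: d_def d'_def)
  then show "x'\<^sup>2 + y'\<^sup>2 \<le> x\<^sup>2 + y\<^sup>2" by linarith
  assume "y + 1 < x"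
  then have "\<bar>d'\<bar> < \<bar>d\<bar>" using d' by (simp add: d_def)
  then have "d'\<^sup>2 < d\<^sup>2" by (metis abs_le_square_iff not_le)
  then have "int (x'\<^sup>2 + y'\<^sup>2) < int (x\<^sup>2 + y\<^sup>2)"
    using e[of x y] e[of x' y'] s by (simp add: d_def d'_def)
  then show "x'\<^sup>2 + y'\<^sup>2 < x\<^sup>2 + y\<^sup>2" by linarith
qed


text \<open>On each initial segment m leads m' by 0 or 1, so on \<open>D - E\<close> the lead is a
  difference of two such numbers. A two-sided bound on initial segments would give only 2.\<close>

lemma count_in_diff_balanced:
  assumes "finite C" and bal: "\<And>D. D \<in> down_sets C \<Longrightarrow> count_in D m' \<le> count_in D m \<and> count_in D m \<le> count_in D m' + 1"
    and D: "D \<in> down_sets C" and E: "E \<in> down_sets C"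
  shows "count_in (D - E) m \<le> count_in (D - E) m' + 1" "count_in (D - E) m' \<le> count_in (D - E) m + 1"
proof -
  have "count_in (D - E) m \<le> count_in (D - E) m' + 1 \<and> count_in (D - E) m' \<le> count_in (D - E) m + 1"
  proof (cases "D \<subseteq> E")
    case True
    then have "D - E = {}" by auto
    then have "count_in (D - E) w = 0" for w :: "'a mon" by (simp only: count_in_empty)
    then show ?thesis by simp
  next
    case False
    then have "E \<subseteq> D" using down_sets_chain[OF D E] by auto
    moreover have "finite D" using down_sets_subset[OF D] assms(1) finite_subset by blast
    ultimately have "count_in D w = count_in (D - E) w + count_in E w" for w by (rule count_in_diff[rotated])
    from this[of m] this[of m'] show ?thesis using bal[OF D] bal[OF E] by linarith
  qed
  then show "count_in (D - E) m \<le> count_in (D - E) m' + 1" "count_in (D - E) m' \<le> count_in (D - E) m + 1"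
    by auto
qed

lemma restr_split: "u = restr S u + restr (- S) u"
  by (rule poly_mapping_eqI) (simp add: lookup_add lookup_restr)

section \<open>Sorted monomials and their uniqueness\<close>

context nested_orders
begin

text \<open>The joint letters are split anew by \<open>balanced_split\<close>. Their product is
  standard, so both portions are standard; once their types are known they represent elements of
  \<open>N\<close>, and \<open>weight2\<close> drops because the old split was unbalanced on
  \<open>D - E\<close>.\<close>

lemma nonstandard_unbalanced_pair:
  assumes N: "n \<in> N" "n' \<in> N" and std: "std_expr n + std_expr n' \<notin> nonstandard C RC"
    and sh: "shape n = shape n'" and DE: "D \<in> down_sets C" "E \<in> down_sets C"
    and cnt: "count_in (D - E) (std_expr n') + 1 < count_in (D - E) (std_expr n)"
  shows "Poly_Mapping.single n 1 + Poly_Mapping.single n' 1 \<in> nonstandard N RN"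
proof -
  have mon: "std_expr n + std_expr n' \<in> monomials C" using std_expr(1) N by simp
  obtain m m' where sum: "std_expr n + std_expr n' = m + m'"
    and "\<forall>D\<in>down_sets C. count_in D m' \<le> count_in D m \<and> count_in D m \<le> count_in D m' + 1"
    using balanced_split[OF finite_C mon] by blast
  then have bal: "count_in (D - E) m \<le> count_in (D - E) m' + 1" "count_in (D - E) m' \<le> count_in (D - E) m + 1"
    if "D \<in> down_sets C" "E \<in> down_sets C" for D E
    using count_in_diff_balanced[OF finite_C _ that, of m' m] by blast+
  have mC: "m \<in> monomials C" "m' \<in> monomials C" using mon sum monomials_add by metis+
  have ms: "m \<notin> nonstandard C RC" "m' \<notin> nonstandard C RC"
    using standard_divisor[of m m'] standard_divisor[of m' m] mC std sum by (auto simp: add.commute)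
  have "lookup (type_of m) i = lookup (shape n) i \<and> lookup (type_of m') i = lookup (shape n) i" for i
  proof -
    have e: "{b \<in> C. idx b = i} = {b \<in> C. i \<le> idx b} - {b \<in> C. i < idx b}" by auto
    have "lookup (type_of m) i \<le> lookup (type_of m') i + 1" "lookup (type_of m') i \<le> lookup (type_of m) i + 1"
      unfolding lookup_type_of[OF mC(1)] lookup_type_of[OF mC(2)] e
      by (rule bal[OF down_set_idx])+
    \<comment> \<open>The two counts of block i differ by at most 1 and have an even sum, so they
      are equal.\<close>
    moreover have "lookup (type_of m) i + lookup (type_of m') i = 2 * lookup (shape n) i"
      using arg_cong[OF sum, of "\<lambda>x. lookup (type_of x) i"] sh by (simp add: type_of_add lookup_add shape_def)
    ultimately show ?thesis by presburger
  qed
  then have mt: "type_of m = shape n" "type_of m' = shape n" by (auto intro: poly_mapping_eqI)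
  note x = std_expr_toric_mon[OF mC(1) ms(1)] and x' = std_expr_toric_mon[OF mC(2) ms(2)]
  let ?u = "Poly_Mapping.single n 1 + Poly_Mapping.single n' (1::nat)"
  let ?v = "Poly_Mapping.single (toric_mon m) 1 + Poly_Mapping.single (toric_mon m') (1::nat)"
  have uN: "?u \<in> monomials N" using N by simp
  have vN: "?v \<in> monomials N" using x(1) x'(1) mt std_expr(4) N by simp
  have e: "std_expr (toric_mon m) = m" "std_expr (toric_mon m') = m'"
    "shape (toric_mon m) = shape n'" "shape (toric_mon m') = shape n'" "shape n = shape n'"
    using x(2,3) x'(2,3) mt std_expr(4) N sh by auto
  have sv: "shapes ?v = shapes ?u" by (simp add: shapes_add e)
  have lv: "letters ?v = letters ?u" using sum by (simp add: letters_add e)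
  \<comment> \<open>For two variables of equal shape \<open>weight1\<close> depends only on their
    joint letters.\<close>
  have w1: "lin_ext weight1 ?v = lin_ext weight1 ?u"
    using arg_cong[OF sum, of "lin_ext (\<lambda>b. card {b' \<in> C. b \<le> b'})"]
    by (simp add: lin_ext_add weight1_def e flip: distrib_left)
  have "count_in F (std_expr n) + count_in F (std_expr n') = count_in F m + count_in F m'" for F
    using arg_cong[OF sum, of "count_in F"] by (simp add: count_in_add)
  note sq = sum_squares_balanced[OF this]
  have w2: "lin_ext weight2 ?v < lin_ext weight2 ?u"
  proof -
    have "(\<Sum>(D, E)\<in>down_sets C \<times> down_sets C. (count_in (D - E) m)\<^sup>2 + (count_in (D - E) m')\<^sup>2) <
        (\<Sum>(D, E)\<in>down_sets C \<times> down_sets C. (count_in (D - E) (std_expr n))\<^sup>2 + (count_in (D - E) (std_expr n'))\<^sup>2)"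
    proof (rule sum_strict_mono_ex1)
      show "finite (down_sets C \<times> down_sets C)" using finite_C finite_down_sets by blast
      show "\<forall>x\<in>down_sets C \<times> down_sets C. (case x of (D, E) \<Rightarrow> (count_in (D - E) m)\<^sup>2 + (count_in (D - E) m')\<^sup>2)
          \<le> (case x of (D, E) \<Rightarrow> (count_in (D - E) (std_expr n))\<^sup>2 + (count_in (D - E) (std_expr n'))\<^sup>2)"
        using sq(1) bal by fast
      show "\<exists>x\<in>down_sets C \<times> down_sets C. (case x of (D, E) \<Rightarrow> (count_in (D - E) m)\<^sup>2 + (count_in (D - E) m')\<^sup>2)
          < (case x of (D, E) \<Rightarrow> (count_in (D - E) (std_expr n))\<^sup>2 + (count_in (D - E) (std_expr n'))\<^sup>2)"
        using sq(2)[OF bal[OF DE] cnt] DE by (intro bexI[of _ "(D, E)"]) auto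
    qed
    then show ?thesis by (simp add: lin_ext_add weight2_def e sum.distrib case_prod_unfold)
  qed
  have "(?v, ?u) \<in> RN" unfolding RN_def using uN vN sv lv w1 w2 by (simp add: lex_order_def)
  moreover have "?v \<noteq> ?u" using w2 by (metis less_irrefl)
  moreover have "toric_mon ?v = toric_mon ?u"
    using toric_mon_letters[OF vN] toric_mon_letters[OF uN] lv by simp
  ultimately show ?thesis using uN vN unfolding nonstandard_def by blast
qed

text \<open>The first clause is what \<open>weight1\<close> enforces, the second what
  \<open>weight2\<close> enforces. Balance is stated in one direction only, as
  \<open>sorted_mon\<close> runs through both orders of a pair.\<close>

definition sorted_pair :: "'b mon \<Rightarrow> 'b mon \<Rightarrow> bool" where
  "sorted_pair n n' \<longleftrightarrow>
     (shape n < shape n' \<longrightarrow>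
       (\<forall>b\<in>keys (std_expr n). \<forall>b'\<in>keys (std_expr n'). idx b = idx b' \<longrightarrow> b \<le> b')) \<and>
     (shape n = shape n' \<longrightarrow> (\<forall>D\<in>down_sets C. \<forall>E\<in>down_sets C.
       count_in (D - E) (std_expr n) \<le> count_in (D - E) (std_expr n') + 1))"

definition sorted_mon :: "'b mon mon \<Rightarrow> bool" where
  "sorted_mon u \<longleftrightarrow> (\<forall>n\<in>keys u. \<forall>n'\<in>keys u. sorted_pair n n')"

lemma nonstandard_not_sorted_pair:
  assumes N: "n \<in> N" "n' \<in> N" and std: "std_expr n + std_expr n' \<notin> nonstandard C RC"
    and "\<not> sorted_pair n n'"
  shows "Poly_Mapping.single n 1 + Poly_Mapping.single n' 1 \<in> nonstandard N RN"
  using assms(4) nonstandard_unsorted_pair[OF N std] nonstandard_unbalanced_pair[OF N std]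
  unfolding sorted_pair_def by (metis not_le)

text \<open>The part of u of shape a, for any a; the name refers to its use with the least shape
  that occurs in u.\<close>

abbreviation least_class :: "'b mon mon \<Rightarrow> 't mon \<Rightarrow> 'b mon mon" where
  "least_class u a \<equiv> restr {n. shape n = a} u"

lemma mon_degree_class: "mon_degree (least_class u a) = lookup (shapes u) a"
  unfolding restr_def shapes_def lookup_lin_ext mon_degree_lin_ext_eq
  by (rule lin_ext_cong) (simp add: lookup_single)

lemma class_type:
  "lookup (type_of (letters (least_class u a))) i = lookup (shapes u) a * lookup a i"
proof -
  have "lookup (type_of (letters (least_class u a))) i = lin_ext (\<lambda>n. lookup (shape n) i) (least_class u a)"
    unfolding toric_mon_shapes[symmetric] shapes_def lin_ext_lin_ext lookup_lin_ext by simp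
  also have "\<dots> = lin_ext (\<lambda>_. lookup a i) (least_class u a)"
    by (rule lin_ext_cong) (auto simp: keys_restr)
  finally show ?thesis by (simp add: lin_ext_const_nat mon_degree_class)
qed

lemma class_monomials: "u \<in> monomials N \<Longrightarrow> restr S u \<in> monomials N"
  using divides_restr divides_monomials by blast

text \<open>Sortedness across different shapes forces the letters of the least shape to be the least
  letters of their block, so their distribution depends only on \<open>shapes u\<close> and \<open>letters u\<close>.\<close>

lemma class_block_count:
  assumes u: "u \<in> monomials N" "sorted_mon u" and a: "\<And>a'. a' \<in> keys (shapes u) \<Longrightarrow> a \<le> a'"
    and D: "D \<in> down_sets C"
  shows "count_in (D \<inter> {b \<in> C. idx b = i}) (letters (least_class u a)) =
    min (lookup (shapes u) a * lookup a i) (count_in (D \<inter> {b \<in> C. idx b = i}) (letters u))"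
proof -
  let ?B = "{b \<in> C. idx b = i}"
  define uc where "uc = least_class u a"
  define ur where "ur = restr (- {n. shape n = a}) u"
  have "letters u = letters uc + letters ur"
    unfolding uc_def ur_def using restr_split[of u "{n. shape n = a}"] by (metis letters_add)
  then have tot: "count_in (D \<inter> ?B) (letters u) = count_in (D \<inter> ?B) (letters uc) + count_in (D \<inter> ?B) (letters ur)"
    by (simp add: count_in_add)
  have ucN: "uc \<in> monomials N" unfolding uc_def using u(1) by (rule class_monomials)
  have fin: "finite ?B" "finite (D \<inter> ?B)" "finite (?B - D \<inter> ?B)" using finite_C by auto
  have full: "count_in ?B (letters uc) = lookup (shapes u) a * lookup a i"
    using lookup_type_of[OF letters_monomials[OF ucN], of i] class_type[of a u i] by (simp add: uc_def)
  have part: "count_in ?B (letters uc) = count_in (?B - D \<inter> ?B) (letters uc) + count_in (D \<inter> ?B) (letters uc)"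
    by (rule count_in_diff[OF fin(1)]) auto
  \<comment> \<open>If a letter of block i in \<open>D\<close> belongs to a larger shape, then all
    letters of block i in the class lie below it and hence in \<open>D\<close>. So the class either
    takes all letters of the block in \<open>D\<close> or has all its own letters of the block
    there; the minimum covers both cases.\<close>
  have "count_in (?B - D \<inter> ?B) (letters uc) = 0" if nz: "count_in (D \<inter> ?B) (letters ur) \<noteq> 0"
  proof -
    obtain b' where b': "b' \<in> D" "idx b' = i" "b' \<in> keys (letters ur)"
      using nz fin(2) by (auto simp: count_in_eq_0)
    then obtain n' where n': "n' \<in> keys ur" "b' \<in> keys (std_expr n')"
      by (auto simp: letters_def in_keys_lin_ext)
    then have n'u: "n' \<in> keys u" "shape n' \<noteq> a" by (auto simp: ur_def keys_restr)
    have "shape n' \<in> keys (shapes u)"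
      unfolding shapes_def in_keys_lin_ext using n'u by (intro bexI[of _ n']) auto
    then have lt: "a < shape n'" using a n'u by (simp add: order_less_le)
    have "b \<in> D" if b: "b \<in> ?B" "b \<in> keys (letters uc)" for b
    proof -
      obtain n where n: "n \<in> keys uc" "b \<in> keys (std_expr n)"
        using b(2) by (auto simp: letters_def in_keys_lin_ext)
      then have "n \<in> keys u" "shape n = a" by (auto simp: uc_def keys_restr)
      then have "sorted_pair n n'" "shape n < shape n'" using u(2) n'u lt by (auto simp: sorted_mon_def)
      then have "b \<le> b'" using n(2) n'(2) b(1) b'(2) by (auto simp: sorted_pair_def)
      then show ?thesis using D b'(1) b(1) by (auto simp: down_sets_def)
    qed
    then show ?thesis using fin(3) by (auto simp: count_in_eq_0)
  qed
  then show ?thesis using tot full part unfolding uc_def by (cases "count_in (D \<inter> ?B) (letters ur) = 0") auto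
qed

lemma count_in_blocks:
  assumes "D \<subseteq> C"
  shows "count_in D m = (\<Sum>i\<in>idx ` C. count_in (D \<inter> {b \<in> C. idx b = i}) m)"
proof -
  have "finite D" using assms finite_C finite_subset by blast
  then have "count_in D m = (\<Sum>i\<in>idx ` C. \<Sum>b\<in>{b \<in> D. idx b = i}. lookup m b)"
    unfolding count_in_def by (intro sum.group[symmetric]) (use finite_C assms in auto)
  moreover have "{b \<in> D. idx b = i} = D \<inter> {b \<in> C. idx b = i}" for i using assms by auto
  ultimately show ?thesis by (simp add: count_in_def)
qed

text \<open>If n leads on \<open>D\<close> and n' leads on \<open>E\<close>, where one segment
  contains the other, then the counts on the difference are at least 2 apart, against balance. So
  comparing all counts together is a total preorder on the class.\<close>

lemma class_has_max:
  assumes "sorted_mon u" "least_class u a \<noteq> 0"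
  shows "\<exists>n\<in>keys (least_class u a). \<forall>n'\<in>keys (least_class u a). \<forall>D\<in>down_sets C.
    count_in D (std_expr n') \<le> count_in D (std_expr n)"
proof (rule finite_total_has_max)
  show "keys (least_class u a) \<noteq> {}" using assms(2) by simp
  fix n n' assume n: "n \<in> keys (least_class u a)" "n' \<in> keys (least_class u a)"
  then have "shape n = shape n'" "sorted_pair n n'" "sorted_pair n' n"
    using assms(1) by (auto simp: keys_restr sorted_mon_def)
  then have bal: "count_in (D - E) (std_expr n) \<le> count_in (D - E) (std_expr n') + 1"
      "count_in (D - E) (std_expr n') \<le> count_in (D - E) (std_expr n) + 1"
    if "D \<in> down_sets C" "E \<in> down_sets C" for D E
    using that by (auto simp: sorted_pair_def)
  show "(\<forall>D\<in>down_sets C. count_in D (std_expr n) \<le> count_in D (std_expr n')) \<or>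
      (\<forall>D\<in>down_sets C. count_in D (std_expr n') \<le> count_in D (std_expr n))"
  proof (rule ccontr)
    assume "\<not> ?thesis"
    then obtain D E where D: "D \<in> down_sets C" "count_in D (std_expr n') < count_in D (std_expr n)"
      and E: "E \<in> down_sets C" "count_in E (std_expr n) < count_in E (std_expr n')"
      by (metis not_le)
    have fin: "finite D" "finite E" using D(1) E(1) down_sets_subset finite_C finite_subset by metis+
    from down_sets_chain[OF D(1) E(1)] show False
    proof
      assume "D \<subseteq> E"
      note d = count_in_diff[OF fin(2) this]
      show False using d[of "std_expr n"] d[of "std_expr n'"] D(2) E(2) bal(2)[OF E(1) D(1)] by linarith
    next
      assume "E \<subseteq> D"
      note d = count_in_diff[OF fin(1) this]
      show False using d[of "std_expr n"] d[of "std_expr n'"] D(2) E(2) bal(1)[OF D(1) E(1)] by linarith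
    qed
  qed
qed (auto intro: order_trans)

text \<open>Every count in the class is \<open>count_in D (std_expr n)\<close> or one less, and n
  attains it. The two inequalities say that this count is the average over the class, rounded
  up.\<close>

lemma class_max_count:
  assumes u: "sorted_mon u" and n: "n \<in> keys (least_class u a)"
    and max: "\<And>n'. n' \<in> keys (least_class u a) \<Longrightarrow> count_in D (std_expr n') \<le> count_in D (std_expr n)"
    and D: "D \<in> down_sets C"
  shows "count_in D (letters (least_class u a)) \<le> lookup (shapes u) a * count_in D (std_expr n)"
    and "lookup (shapes u) a * count_in D (std_expr n) <
      count_in D (letters (least_class u a)) + lookup (shapes u) a"
proof -
  let ?uc = "least_class u a" and ?M = "count_in D (std_expr n)"
  have c: "count_in D (letters ?uc) = (\<Sum>n'\<in>keys ?uc. lookup ?uc n' * count_in D (std_expr n'))"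
    by (simp add: letters_def count_in_lin_ext lin_ext_nat)
  have k: "lookup (shapes u) a = (\<Sum>n'\<in>keys ?uc. lookup ?uc n')"
    unfolding mon_degree_class[symmetric] mon_degree_def ..
  show "count_in D (letters ?uc) \<le> lookup (shapes u) a * ?M"
    unfolding c k sum_distrib_right by (rule sum_mono) (simp add: max)
  have M: "?M \<le> count_in D (std_expr n') + 1" if n': "n' \<in> keys ?uc" for n'
  proof -
    have "shape n = shape n'" "sorted_pair n n'"
      using u n n' by (auto simp: keys_restr sorted_mon_def)
    then have "count_in (D - {}) (std_expr n) \<le> count_in (D - {}) (std_expr n') + 1"
      using D empty_down_set unfolding sorted_pair_def by blast
    then show ?thesis by simp
  qed
  have "(\<Sum>n'\<in>keys ?uc. lookup ?uc n' * ?M) < (\<Sum>n'\<in>keys ?uc. lookup ?uc n' * (count_in D (std_expr n') + 1))"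
  proof (rule sum_strict_mono_ex1)
    show "\<forall>n'\<in>keys ?uc. lookup ?uc n' * ?M \<le> lookup ?uc n' * (count_in D (std_expr n') + 1)"
      using M mult_le_mono2 by blast
    show "\<exists>n'\<in>keys ?uc. lookup ?uc n' * ?M < lookup ?uc n' * (count_in D (std_expr n') + 1)"
      using n by (intro bexI[of _ n]) (auto simp: in_keys_iff)
  qed simp
  then show "lookup (shapes u) a * ?M < count_in D (letters ?uc) + lookup (shapes u) a"
    unfolding c k sum_distrib_right by (simp add: distrib_left sum.distrib)
qed

text \<open>In the least shape, the classes of u and v have the same degree and, by
  \<open>class_block_count\<close>, the same letter counts on every initial segment. The dominating
  variables of the two classes have the same rounded-up averages as counts, hence the same standard
  expression.\<close>

lemma sorted_mon_common_variable:
  assumes u: "u \<in> monomials N" "sorted_mon u" and v: "v \<in> monomials N" "sorted_mon v"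
    and eq: "shapes u = shapes v" "letters u = letters v" and "u \<noteq> 0"
  shows "\<exists>n. n \<in> keys u \<and> n \<in> keys v"
proof -
  have "shapes u \<noteq> 0" using mon_degree_shapes[of u] \<open>u \<noteq> 0\<close> by (metis mon_degree_eq_0_iff)
  then have ne: "keys (shapes u) \<noteq> {}" by simp
  define a where "a = Min (keys (shapes u))"
  have a: "a \<in> keys (shapes u)" "\<And>a'. a' \<in> keys (shapes u) \<Longrightarrow> a \<le> a'"
    using ne unfolding a_def by (auto intro: Min_in)
  have nz: "lookup (shapes u) a \<noteq> 0" using a(1) by (simp add: in_keys_iff)
  have uc: "least_class u a \<noteq> 0" using nz mon_degree_class[of a u] by (metis mon_degree_zero)
  have vc: "least_class v a \<noteq> 0" using nz mon_degree_class[of a v] eq(1) by (metis mon_degree_zero)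
  obtain n where n: "n \<in> keys (least_class u a)"
    "\<forall>n'\<in>keys (least_class u a). \<forall>D\<in>down_sets C. count_in D (std_expr n') \<le> count_in D (std_expr n)"
    using class_has_max[OF u(2) uc] by blast
  obtain n' where n': "n' \<in> keys (least_class v a)"
    "\<forall>n\<in>keys (least_class v a). \<forall>D\<in>down_sets C. count_in D (std_expr n) \<le> count_in D (std_expr n')"
    using class_has_max[OF v(2) vc] by blast
  have inN: "n \<in> N" "n' \<in> N" using n(1) n'(1) u(1) v(1) by (auto simp: keys_restr monomials_def)
  have "std_expr n = std_expr n'"
  proof (rule down_set_counts_determine[OF finite_C std_expr(1)[OF inN(1)] std_expr(1)[OF inN(2)]])
    fix D assume D: "D \<in> down_sets C"
    have "count_in D (letters (least_class u a)) = count_in D (letters (least_class v a))"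
      unfolding count_in_blocks[OF down_sets_subset[OF D]]
    proof (rule sum.cong)
      fix i
      have a': "a' \<in> keys (shapes v) \<Longrightarrow> a \<le> a'" for a' using a(2) eq(1) by simp
      show "count_in (D \<inter> {b \<in> C. idx b = i}) (letters (least_class u a)) =
          count_in (D \<inter> {b \<in> C. idx b = i}) (letters (least_class v a))"
        using class_block_count[OF u a(2) D, of i] class_block_count[OF v a' D, of i] eq by simp
    qed simp
    moreover have "count_in D (letters (least_class u a)) \<le> lookup (shapes u) a * count_in D (std_expr n)"
      "lookup (shapes u) a * count_in D (std_expr n) < count_in D (letters (least_class u a)) + lookup (shapes u) a"
      using class_max_count[OF u(2) n(1) _ D] n(2) D by blast+
    moreover have "count_in D (letters (least_class v a)) \<le> lookup (shapes u) a * count_in D (std_expr n')"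
      "lookup (shapes u) a * count_in D (std_expr n') < count_in D (letters (least_class v a)) + lookup (shapes u) a"
      using class_max_count[OF v(2) n'(1) _ D] n'(2) D unfolding eq(1) by blast+
    \<comment> \<open>Both counts M satisfy c \<le> k * M < c + k with the same c and k, which has
      at most one solution.\<close>
    ultimately have "lookup (shapes u) a * count_in D (std_expr n) < lookup (shapes u) a * (count_in D (std_expr n') + 1)"
      "lookup (shapes u) a * count_in D (std_expr n') < lookup (shapes u) a * (count_in D (std_expr n) + 1)"
      by (simp_all add: distrib_left)
    then have "count_in D (std_expr n) < count_in D (std_expr n') + 1"
      "count_in D (std_expr n') < count_in D (std_expr n) + 1"
      unfolding mult_less_cancel1 by blast+
    then show "count_in D (std_expr n) = count_in D (std_expr n')" by linarith
  qed
  then have "n = n'" using std_expr(3)[OF inN(1)] std_expr(3)[OF inN(2)] by metis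
  then show ?thesis using n(1) n'(1) by (auto simp: keys_restr)
qed

text \<open>A common variable is cancelled; sortedness is a condition on pairs of variables and
  passes to divisors.\<close>

lemma sorted_mon_unique:
  "u \<in> monomials N \<Longrightarrow> sorted_mon u \<Longrightarrow> v \<in> monomials N \<Longrightarrow> sorted_mon v \<Longrightarrow>
    shapes u = shapes v \<Longrightarrow> letters u = letters v \<Longrightarrow> u = v"
proof (induction "mon_degree u" arbitrary: u v rule: less_induct)
  case less
  show ?case
  proof (cases "u = 0")
    case True
    then have "mon_degree v = 0" using mon_degree_shapes[of v] less.prems(5) by simp
    then show ?thesis using True by simp
  next
    case False
    obtain n where n: "n \<in> keys u" "n \<in> keys v"
      using sorted_mon_common_variable[OF less.prems False] by blast
    define u' where "u' = u - Poly_Mapping.single n 1"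
    define v' where "v' = v - Poly_Mapping.single n 1"
    have u: "u = u' + Poly_Mapping.single n 1" unfolding u'_def by (rule sub_single_add[OF n(1)])
    have v: "v = v' + Poly_Mapping.single n 1" unfolding v'_def by (rule sub_single_add[OF n(2)])
    have "u' = v'"
    proof (rule less.hyps)
      show "mon_degree u' < mon_degree u" by (simp add: u mon_degree_add)
      show "u' \<in> monomials N" "v' \<in> monomials N" using less.prems(1,3) u v by simp_all
      show "sorted_mon u'" "sorted_mon v'" using less.prems(2,4) unfolding u v
        by (auto simp: sorted_mon_def keys_add_nat)
      show "shapes u' = shapes v'" "letters u' = letters v'"
        using less.prems(5,6) unfolding u v by (auto simp: shapes_add letters_add)
    qed
    then show ?thesis by (simp add: u v)
  qed
qed

text \<open>A nonstandard u without a restricted nonstandard divisor is compared with the standard v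
  of its fibre. Both have standard shapes, standard letters and sorted pairs, so their letters
  agree, then their shapes, and \<open>sorted_mon_unique\<close> gives the contradiction u =
  v.\<close>

theorem divisor_generated_N:
  assumes "finite N"
    and deg: "\<And>u v. u \<in> monomials N \<Longrightarrow> v \<in> monomials N \<Longrightarrow> toric_mon u = toric_mon v \<Longrightarrow> mon_degree u = mon_degree v"
    and gA: "divisor_generated (restricted_mon q) (nonstandard A RA)"
    and gC: "divisor_generated (restricted_mon q) (nonstandard C RC)"
    and q: "\<And>k. q = Some k \<Longrightarrow> 2 \<le> k"
  shows "divisor_generated (restricted_mon q) (nonstandard N RN)"
proof (intro ballI, rule ccontr)
  fix u assume uNS: "u \<in> nonstandard N RN"
    and no: "\<not> (\<exists>s\<in>nonstandard N RN. divides s u \<and> restricted_mon q s)"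
  have u: "u \<in> monomials N" using uNS nonstandard_subset by blast
  obtain v where v: "v \<in> monomials N" "v \<notin> nonstandard N RN" "toric_mon v = toric_mon u"
    using exists_standard[OF monomial_order_RN \<open>finite N\<close> u] deg[OF _ u] by (metis order_refl)
  have clean: "shapes w \<notin> nonstandard A RA \<and> letters w \<notin> nonstandard C RC \<and> sorted_mon w"
    if w: "w \<in> monomials N" and no: "\<not> (\<exists>s\<in>nonstandard N RN. divides s w \<and> restricted_mon q s)" for w
  proof (intro conjI)
    show "shapes w \<notin> nonstandard A RA"
    proof
      assume "shapes w \<in> nonstandard A RA"
      then obtain s where s: "s \<in> nonstandard A RA" "divides s (shapes w)" "restricted_mon q s" using gA by blast
      \<comment> \<open>The generator s lives over \<open>A\<close>; it is transported to a divisor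
        of w obeying the same restriction.\<close>
      obtain w' where w': "divides w' w" "divides s (shapes w')" "restricted_mon q w'"
        using restricted_divisor[OF s(2)[unfolded shapes_def] s(3)] unfolding shapes_def by blast
      have "w' \<in> monomials N" using divides_monomials[OF w'(1) w] .
      then have "w' \<in> nonstandard N RN"
        using nonstandard_shapes nonstandard_divides[OF RA s(1) w'(2)] shapes_monomials by blast
      then show False using no w' by blast
    qed
    show ln: "letters w \<notin> nonstandard C RC"
    proof
      assume "letters w \<in> nonstandard C RC"
      then obtain s where s: "s \<in> nonstandard C RC" "divides s (letters w)" "restricted_mon q s" using gC by blast
      obtain w' where w': "divides w' w" "divides s (letters w')" "restricted_mon q w'"
        using restricted_divisor[OF s(2)[unfolded letters_def] s(3)] unfolding letters_def by blast
      have "w' \<in> monomials N" using divides_monomials[OF w'(1) w] .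
      then have "w' \<in> nonstandard N RN"
        using nonstandard_letters nonstandard_divides[OF RC s(1) w'(2)] letters_monomials by blast
      then show False using no w' by blast
    qed
    show "sorted_mon w"
      unfolding sorted_mon_def
    proof (intro ballI, rule ccontr)
      fix n n' assume n: "n \<in> keys w" "n' \<in> keys w" and ns: "\<not> sorted_pair n n'"
      \<comment> \<open>A variable is sorted relative to itself, so an unsorted pair consists of
        distinct variables.\<close>
      have "n \<noteq> n'" using ns by (auto simp: sorted_pair_def)
      let ?p = "Poly_Mapping.single n 1 + Poly_Mapping.single n' (1::nat)"
      have dv: "divides ?p w"
        using n \<open>n \<noteq> n'\<close> by (auto simp: divides_def lookup_add lookup_single when_def in_keys_iff Suc_le_eq)
      then obtain z where "w = ?p + z" by (auto simp: divides_iff)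
      then have "letters w = (std_expr n + std_expr n') + letters z"
        by (simp add: letters_add)
      then have "std_expr n + std_expr n' \<notin> nonstandard C RC"
        using ln standard_divisor letters_monomials[OF w] by metis
      moreover have "n \<in> N" "n' \<in> N" using n w by (auto simp: monomials_def)
      ultimately have "?p \<in> nonstandard N RN" using nonstandard_not_sorted_pair ns by blast
      then show False using no dv restricted_mon_pair[OF \<open>n \<noteq> n'\<close> q] by blast
    qed
  qed
  have "\<not> (\<exists>s\<in>nonstandard N RN. divides s v \<and> restricted_mon q s)"
    using nonstandard_divides[OF monomial_order_RN] v by blast
  note cu = clean[OF u no] and cv = clean[OF v(1) this]
  have "letters u = letters v"
    by (rule standard_unique[OF RC])
      (use cu cv u v letters_monomials toric_mon_letters in auto)
  \<comment> \<open>Equal letters have equal types, so the shapes of u and v lie in one fibre over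
    \<open>A\<close>.\<close>
  moreover from this have "shapes u = shapes v"
    by (intro standard_unique[OF RA])
      (use cu cv u v shapes_monomials toric_mon_shapes in auto)
  ultimately have "u = v" using sorted_mon_unique u v(1) cu cv by blast
  then show False using uNS v(2) by blast
qed

end


section \<open>Nested configurations\<close>

lemma mon_as_sum:
  "\<exists>f. (\<forall>k\<in>{1..mon_degree m}. f k \<in> keys m) \<and> m = (\<Sum>k=1..mon_degree m. Poly_Mapping.single (f k) (1::nat))"
proof (induction m rule: mon_induct)
  case zero
  then show ?case by simp
next
  case (add m x)
  then obtain f where f: "\<forall>k\<in>{1..mon_degree m}. f k \<in> keys m"
      "m = (\<Sum>k=1..mon_degree m. Poly_Mapping.single (f k) (1::nat))" by blast
  let ?g = "f(Suc (mon_degree m) := x)"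
  have "(\<Sum>k=1..mon_degree m. Poly_Mapping.single (?g k) (1::nat)) = (\<Sum>k=1..mon_degree m. Poly_Mapping.single (f k) 1)"
    by (rule sum.cong) auto
  then have "m + Poly_Mapping.single x 1 = (\<Sum>k=1..Suc (mon_degree m). Poly_Mapping.single (?g k) (1::nat))"
    using f(2) by (simp add: add.commute)
  moreover have "\<forall>k\<in>{1..Suc (mon_degree m)}. ?g k \<in> keys (m + Poly_Mapping.single x 1)"
    using f(1) by (auto simp: keys_add_nat)
  moreover have "mon_degree (m + Poly_Mapping.single x 1) = Suc (mon_degree m)" by (simp add: mon_degree_add)
  ultimately show ?case by metis
qed

text \<open>Exponent vectors are compared at the first variable where they differ, so monomials in
  smaller variables are larger. This is why \<open>idx\<close> is antimonotone in
  \<open>nested_orders\<close>.\<close>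

lemma mon_less_disjoint_keys:
  fixes m m' :: "'v::linorder mon"
  assumes "m \<noteq> 0" and lt: "\<And>x y. x \<in> keys m \<Longrightarrow> y \<in> keys m' \<Longrightarrow> x < y"
  shows "m' < m"
proof -
  define k where "k = Min (keys m)"
  have k: "k \<in> keys m" "\<And>x. x \<in> keys m \<Longrightarrow> k \<le> x"
    using assms(1) by (auto simp: k_def intro: Min_in)
  have "k \<notin> keys m'" using lt[OF k(1)] by blast
  then have "lookup m' k < lookup m k" using k(1) by (simp add: in_keys_iff)
  moreover have "lookup m' x = lookup m x" if "x < k" for x
  proof -
    have "x \<notin> keys m" using k(2) that by fastforce
    moreover have "x \<notin> keys m'" using lt[OF k(1)] that by fastforce
    ultimately show ?thesis by (simp add: in_keys_iff)
  qed
  ultimately show ?thesis unfolding less_poly_mapping.rep_eq less_fun_def by blast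
qed

lemma real_lin_ext_nat: "real (lin_ext f m) = lin_ext (\<lambda>x. real (f x)) m"
  by (rule lin_ext_hom) auto

lemma lin_ext_const_real: "lin_ext (\<lambda>_. c) m = real (mon_degree m) * c" for c :: real
  by (simp add: lin_ext_def mon_degree_def sum_distrib_right)

text \<open>The restriction q is left open to serve parts (a) and (b) alike. Variables are pairs
  whose first component is the block, so the lexicographic order on pairs keeps each block
  together.\<close>

lemma nested_divisor_generated:
  fixes r :: nat and T :: "nat set" and U :: "nat \<Rightarrow> (nat \<times> nat) set"
    and A :: "nat mon set" and B :: "nat \<Rightarrow> (nat \<times> nat) mon set"
  defines "M \<equiv> nested_configuration r A B"
  assumes finT: "finite T" and finU: "\<And>i. i \<in> T \<Longrightarrow> finite (U i)" and fstU: "\<And>i v. v \<in> U i \<Longrightarrow> fst v = i"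
    and confA: "configuration T A" and degA: "\<forall>a\<in>A. mon_degree a = r"
    and confB: "\<forall>i\<in>T. configuration (U i) (B i)"
  shows "configuration (\<Union>i\<in>T. U i) M"
    and "\<exists>R. monomial_order A R \<and> divisor_generated (restricted_mon q) (nonstandard A R) \<Longrightarrow>
      \<forall>i\<in>T. \<exists>R. monomial_order (B i) R \<and> divisor_generated (restricted_mon q) (nonstandard (B i) R) \<Longrightarrow>
      (\<And>k. q = Some k \<Longrightarrow> 2 \<le> k) \<Longrightarrow>
      \<exists>R. monomial_order M R \<and> divisor_generated (restricted_mon q) (nonstandard M R)"
proof -
  define C where "C = (\<Union>i\<in>T. B i)"
  let ?V = "\<Union>i\<in>T. U i"
  \<comment> \<open>All variables of a letter have the same first component, so the minimum just
    extracts it.\<close>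
  define idx where "idx b = Min (fst ` keys b)" for b :: "(nat \<times> nat) mon"
  define tp where "tp \<beta> = lin_ext (\<lambda>b. Poly_Mapping.single (idx b) (1::nat)) \<beta>" for \<beta>
  have finV: "finite ?V" using finT finU by blast
  have B: "finite (B i)" "B i \<subseteq> monomials (U i)" if "i \<in> T" for i
    using confB that by (auto simp: configuration_def)
  have "\<forall>i\<in>T. \<exists>w :: nat \<times> nat \<Rightarrow> real. \<forall>b\<in>B i. (\<Sum>v\<in>U i. w v * real (lookup b v)) = 1"
    using confB by (simp add: configuration_def)
  then obtain w :: "nat \<Rightarrow> nat \<times> nat \<Rightarrow> real"
    where w: "\<And>i b. i \<in> T \<Longrightarrow> b \<in> B i \<Longrightarrow> (\<Sum>v\<in>U i. w i v * real (lookup b v)) = 1"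
    by metis
  \<comment> \<open>The monomial 1 would have weight 0 instead of 1.\<close>
  have B0: "0 \<notin> B i" if "i \<in> T" for i
    using w[OF that, of 0] by auto
  have idx: "idx b = i" if "i \<in> T" "b \<in> B i" for i b
  proof -
    have "b \<noteq> 0" using B0 that by metis
    then have "keys b \<noteq> {}" by simp
    moreover have "fst v = i" if "v \<in> keys b" for v
      using B(2) \<open>i \<in> T\<close> \<open>b \<in> B i\<close> that by (intro fstU) (auto simp: monomials_def)
    ultimately have "fst ` keys b = {i}" by (simp add: image_constant_conv cong: image_cong)
    then show ?thesis by (simp add: idx_def)
  qed
  have CD: "\<exists>i\<in>T. b \<in> B i \<and> idx b = i" if "b \<in> C" for b
    using that idx by (auto simp: C_def)
  have keysC: "keys b \<subseteq> U (idx b)" "b \<noteq> 0" if b: "b \<in> C" for b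
    using CD[OF b] B(2) B0 by (auto simp: monomials_def)
  have finC: "finite C" using B(1) finT by (simp add: C_def)
  have finA: "finite A" using confA by (simp add: configuration_def)
  have antimono: "idx b' \<le> idx b" if b: "b \<in> C" "b' \<in> C" "b \<le> b'" for b b'
  proof (rule ccontr)
    assume "\<not> idx b' \<le> idx b"
    have "b' < b"
    proof (rule mon_less_disjoint_keys[OF keysC(2)[OF b(1)]])
      fix x y assume "x \<in> keys b" "y \<in> keys b'"
      then have "fst x = idx b" "fst y = idx b'" using keysC(1) b fstU by blast+
      then show "x < y" using \<open>\<not> idx b' \<le> idx b\<close> by (simp add: less_prod_def')
    qed
    then show False using b(3) by simp
  qed
  have weight: "(\<Sum>v\<in>U i. w i v * real (lookup b v)) = (if idx b = i then 1 else 0)" if "b \<in> C" "i \<in> T" for b i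
  proof (cases "idx b = i")
    case True
    have "b \<in> B i" using CD[OF that(1)] True by blast
    then show ?thesis using w[OF that(2)] True by simp
  next
    case False
    have "v \<notin> keys b" if v: "v \<in> U i" for v
    proof
      assume "v \<in> keys b"
      then have "v \<in> U (idx b)" using keysC(1)[OF \<open>b \<in> C\<close>] by (rule subsetD[rotated])
      then show False using False fstU[OF v] fstU[of v "idx b"] by simp
    qed
    then have "lookup b v = 0" if "v \<in> U i" for v
      using that by (simp add: in_keys_iff)
    then show ?thesis using False by simp
  qed
  \<comment> \<open>The weight vector of \<open>B i\<close> takes the value 1 on the letters of
    block i and 0 on all others, so it counts the letters of block i from their product
    alone.\<close>
  have fiber: "tp \<beta> = tp \<beta>'"
    if \<beta>: "\<beta> \<in> monomials C" "\<beta>' \<in> monomials C" "toric_mon \<beta> = toric_mon \<beta>'" for \<beta> \<beta>'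
  proof (rule poly_mapping_eqI)
    fix i
    have lk: "lookup (tp \<gamma>) i = lin_ext (\<lambda>b. if idx b = i then 1 else 0) \<gamma>" for \<gamma>
      unfolding tp_def lookup_lin_ext by (rule lin_ext_cong) (simp add: lookup_single)
    show "lookup (tp \<beta>) i = lookup (tp \<beta>') i"
    proof (cases "i \<in> T")
      case True
      have "real (lookup (tp \<gamma>) i) = (\<Sum>v\<in>U i. w i v * real (lookup (toric_mon \<gamma>) v))"
        if "\<gamma> \<in> monomials C" for \<gamma>
      proof -
        have "(\<Sum>v\<in>U i. w i v * real (lookup (toric_mon \<gamma>) v)) =
            lin_ext (\<lambda>b. \<Sum>v\<in>U i. w i v * real (lookup b v)) \<gamma>"
          by (rule lin_ext_hom) (auto simp: lookup_add algebra_simps sum.distrib)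
        also have "\<dots> = lin_ext (\<lambda>b. real (if idx b = i then 1 else 0)) \<gamma>"
          by (rule lin_ext_cong) (use that True weight in \<open>auto simp: monomials_def\<close>)
        finally show ?thesis by (simp only: lk real_lin_ext_nat)
      qed
      from this[OF \<beta>(1)] this[OF \<beta>(2)] show ?thesis using \<beta>(3) by (metis of_nat_eq_iff)
    next
      case False
      have "lin_ext (\<lambda>b. if idx b = i then 1 else (0::nat)) \<gamma> = lin_ext (\<lambda>_. 0) \<gamma>" if "\<gamma> \<in> monomials C" for \<gamma>
        by (rule lin_ext_cong) (use that False CD in \<open>auto simp: monomials_def\<close>)
      then show ?thesis using \<beta> by (simp add: lk lin_ext_const_nat)
    qed
  qed
  have M: "M = toric_mon ` {\<beta> \<in> monomials C. tp \<beta> \<in> A}"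
  proof (intro subset_antisym subsetI)
    fix x assume "x \<in> M"
    then obtain i m where x: "x = (\<Sum>k=1..r. m k)" and a: "(\<Sum>k=1..r. Poly_Mapping.single (i k) (1::nat)) \<in> A"
      and m: "\<And>k. k \<in> {1..r} \<Longrightarrow> m k \<in> B (i k)"
      unfolding M_def nested_configuration_def by blast
    have iT: "i k \<in> T" if "k \<in> {1..r}" for k
    proof -
      have "1 \<le> (\<Sum>j=1..r. lookup (Poly_Mapping.single (i j) (1::nat)) (i k))"
        by (rule order_trans[OF _ member_le_sum[OF that]]) auto
      then have "i k \<in> keys (\<Sum>k=1..r. Poly_Mapping.single (i k) (1::nat))"
        unfolding in_keys_iff lookup_sum by linarith
      then show ?thesis using a confA by (auto simp: configuration_def monomials_def)
    qed
    define \<beta> where "\<beta> = (\<Sum>k=1..r. Poly_Mapping.single (m k) (1::nat))"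
    have "keys \<beta> \<subseteq> (\<Union>k\<in>{1..r}. keys (Poly_Mapping.single (m k) (1::nat)))"
      unfolding \<beta>_def by (rule keys_sum)
    also have "\<dots> \<subseteq> C"
    proof (rule UN_least)
      fix k assume k: "k \<in> {1..r}"
      have "m k \<in> C" unfolding C_def using m[OF k] iT[OF k] by blast
      then show "keys (Poly_Mapping.single (m k) (1::nat)) \<subseteq> C" by simp
    qed
    finally have "\<beta> \<in> monomials C" by (simp add: monomials_def)
    moreover have "tp \<beta> = (\<Sum>k=1..r. Poly_Mapping.single (i k) (1::nat))"
      unfolding tp_def \<beta>_def lin_ext_sum lin_ext_single
      using idx[OF iT m] by (intro sum.cong) simp_all
    moreover have "toric_mon \<beta> = x" unfolding x \<beta>_def lin_ext_sum lin_ext_single ..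
    ultimately show "x \<in> toric_mon ` {\<beta> \<in> monomials C. tp \<beta> \<in> A}" using a by force
  next
    fix x assume "x \<in> toric_mon ` {\<beta> \<in> monomials C. tp \<beta> \<in> A}"
    then obtain \<beta> where \<beta>: "\<beta> \<in> monomials C" "tp \<beta> \<in> A" "x = toric_mon \<beta>" by blast
    have "mon_degree \<beta> = mon_degree (tp \<beta>)"
      by (simp add: tp_def mon_degree_lin_ext_eq lin_ext_const_nat)
    then have deg: "mon_degree \<beta> = r" using degA \<beta>(2) by simp
    obtain f where f: "\<And>k. k \<in> {1..r} \<Longrightarrow> f k \<in> keys \<beta>"
      and b: "\<beta> = (\<Sum>k=1..r. Poly_Mapping.single (f k) (1::nat))"
      using mon_as_sum[of \<beta>] unfolding deg by blast
    have fB: "f k \<in> B (idx (f k))" if "k \<in> {1..r}" for k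
      using CD[of "f k"] f[OF that] \<beta>(1) by (auto simp: monomials_def)
    have "tp \<beta> = (\<Sum>k=1..r. Poly_Mapping.single (idx (f k)) (1::nat))"
      unfolding tp_def by (subst b) (simp only: lin_ext_sum lin_ext_single)
    moreover have "x = (\<Sum>k=1..r. f k)"
      unfolding \<beta>(3) by (subst b) (simp only: lin_ext_sum lin_ext_single)
    ultimately show "x \<in> M"
      unfolding M_def nested_configuration_def using \<beta>(2) fB
      by (intro CollectI exI[of _ "\<lambda>k. idx (f k)"] exI[of _ f]) auto
  qed
  have deg: "mon_degree \<beta> = r" if "tp \<beta> \<in> A" for \<beta>
  proof -
    have "mon_degree \<beta> = mon_degree (tp \<beta>)"
      by (simp add: tp_def mon_degree_lin_ext_eq lin_ext_const_nat)
    then show ?thesis using degA that by simp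
  qed
  have finM: "finite M"
    unfolding M by (rule finite_imageI, rule finite_subset[OF _ finite_monomials_bounded[OF finC, of r]])
      (use deg in auto)
  \<comment> \<open>For r = 0 the only possible element of \<open>A\<close> is 1, which has weight
    0. Positivity is wanted for the division by r below.\<close>
  have "r > 0" if ne: "M \<noteq> {}"
  proof (rule ccontr)
    assume "\<not> 0 < r"
    obtain \<beta> where "tp \<beta> \<in> A" using ne unfolding M by blast
    moreover from this have "tp \<beta> = 0" using degA \<open>\<not> 0 < r\<close> by (metis mon_degree_eq_0_iff gr0I)
    ultimately show False using confA by (auto simp: configuration_def)
  qed
  show confM: "configuration ?V M"
    unfolding configuration_def
  proof (intro conjI)
    show "M \<subseteq> monomials ?V"
    proof
      fix x assume "x \<in> M"
      then obtain \<beta> where \<beta>: "\<beta> \<in> monomials C" "x = toric_mon \<beta>" unfolding M by blast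
      have "b \<in> monomials ?V" if "b \<in> keys \<beta>" for b
      proof -
        have "b \<in> C" using \<beta>(1) that by (auto simp: monomials_def)
        then show ?thesis using CD keysC(1) unfolding monomials_def by blast
      qed
      then show "x \<in> monomials ?V" unfolding \<beta>(2) by (rule lin_ext_monomials)
    qed
    \<comment> \<open>Each element of \<open>M\<close> is a product of r letters, so the weights of
      the blocks are divided by r.\<close>
    define h where "h x = (\<Sum>v\<in>?V. w (fst v) v / real r * real (lookup x v))" for x :: "(nat \<times> nat) mon"
    have hC: "h b = 1 / real r" if b: "b \<in> C" for b
    proof -
      obtain i where i: "i \<in> T" "b \<in> B i" "idx b = i" using CD[OF b] by blast
      have "h b = (\<Sum>v\<in>U i. w (fst v) v / real r * real (lookup b v))"
        unfolding h_def
      proof (rule sum.mono_neutral_right[OF finV])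
        show "\<forall>v\<in>?V - U i. w (fst v) v / real r * real (lookup b v) = 0"
          using keysC(1)[OF b] i(3) by (auto simp: in_keys_iff)
      qed (use i in auto)
      also have "\<dots> = (\<Sum>v\<in>U i. w i v * real (lookup b v)) / real r"
        unfolding sum_divide_distrib by (rule sum.cong) (auto dest: fstU)
      finally show ?thesis using w[OF i(1,2)] by simp
    qed
    have "h x = 1" if x: "x \<in> M" for x
    proof -
      obtain \<beta> where \<beta>: "\<beta> \<in> monomials C" "tp \<beta> \<in> A" "x = toric_mon \<beta>" using x unfolding M by blast
      have "M \<noteq> {}" using x by blast
      then have r: "0 < r" by (rule \<open>M \<noteq> {} \<Longrightarrow> 0 < r\<close>)
      have "h x = lin_ext h \<beta>" unfolding \<beta>(3)
        by (rule lin_ext_hom) (auto simp: h_def lookup_add algebra_simps sum.distrib)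
      also have "\<dots> = lin_ext (\<lambda>_. 1 / real r) \<beta>"
      proof (rule lin_ext_cong)
        fix b assume "b \<in> keys \<beta>"
        then show "h b = 1 / real r" using \<beta>(1) by (intro hC) (auto simp: monomials_def)
      qed
      also have "\<dots> = 1" using r by (simp add: lin_ext_const_real deg[OF \<beta>(2)])
      finally show ?thesis .
    qed
    then show "\<exists>w :: nat \<times> nat \<Rightarrow> real. \<forall>a\<in>M. (\<Sum>v\<in>?V. w v * real (lookup a v)) = 1"
      unfolding h_def by (intro exI[of _ "\<lambda>v. w (fst v) v / real r"] ballI)
  qed (rule finM)
  assume gA: "\<exists>R. monomial_order A R \<and> divisor_generated (restricted_mon q) (nonstandard A R)"
    and gB: "\<forall>i\<in>T. \<exists>R. monomial_order (B i) R \<and> divisor_generated (restricted_mon q) (nonstandard (B i) R)"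
    and q: "\<And>k. q = Some k \<Longrightarrow> 2 \<le> k"
  obtain RA where ordA: "monomial_order A RA" "divisor_generated (restricted_mon q) (nonstandard A RA)"
    using gA by blast
  have "\<exists>R. monomial_order C R \<and> divisor_generated (restricted_mon q) (nonstandard C R)"
    unfolding C_def
  proof (rule divisor_generated_UN[OF finT B(2) B0])
    show "U i \<inter> U j = {}" if "i \<noteq> j" for i j
      using that fstU by (metis disjoint_iff)
    show "\<exists>R. monomial_order (B i) R \<and> divisor_generated (restricted_mon q) (nonstandard (B i) R)"
      if "i \<in> T" for i
      using gB that by blast
  qed
  then obtain RC where ordC: "monomial_order C RC" "divisor_generated (restricted_mon q) (nonstandard C RC)"
    by blast
  interpret nested_orders A C idx RA RC
  proof
    show "idx b' \<le> idx b" if "b \<in> C" "b' \<in> C" "b \<le> b'" for b b'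
      using that by (rule antimono)
    show "lin_ext (\<lambda>b. Poly_Mapping.single (idx b) (1::nat)) \<beta> = lin_ext (\<lambda>b. Poly_Mapping.single (idx b) 1) \<beta>'"
      if "\<beta> \<in> monomials C" "\<beta>' \<in> monomials C" "toric_mon \<beta> = toric_mon \<beta>'" for \<beta> \<beta>'
      using fiber[OF that] unfolding tp_def .
  qed (fact finA finC ordA(1) ordC(1))+
  have NM: "N = M" unfolding N_def M tp_def type_of_def ..
  have "divisor_generated (restricted_mon q) (nonstandard N RN)"
  proof (rule divisor_generated_N)
    show "finite N" using finM NM by simp
    show "mon_degree u = mon_degree v" if "u \<in> monomials N" "v \<in> monomials N" "toric_mon u = toric_mon v" for u v
      using that unfolding NM by (rule configuration_fiber_degree[OF confM])
  qed (fact ordA(2) ordC(2) q)+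
  then show "\<exists>R. monomial_order M R \<and> divisor_generated (restricted_mon q) (nonstandard M R)"
    using monomial_order_RN NM by metis
qed

theorem mainTheorem3:
  fixes K :: "'k::field itself"
    and d r :: nat and \<mu> :: "nat \<Rightarrow> nat"
    and A :: "nat mon set"
    and B :: "nat \<Rightarrow> (nat \<times> nat) mon set"
  defines "T \<equiv> {1..d}"
    and "U \<equiv> (\<lambda>i. {i} \<times> {1..\<mu> i})"
    and "N \<equiv> nested_configuration r A B"
  assumes "configuration T A"
    and "\<forall>a\<in>A. mon_degree a = r"
    and "\<forall>i\<in>T. \<exists>a\<in>A. lookup a i > 0"
    and "\<forall>i\<in>T. configuration (U i) (B i)"
  shows "(\<forall>p>0.
            has_binomial_groebner_basis A (toric_ideal K T A) p \<and>
            (\<forall>i\<in>T. has_binomial_groebner_basis (B i) (toric_ideal K (U i) (B i)) p) \<longrightarrow>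
            has_binomial_groebner_basis N (toric_ideal K (\<Union>i\<in>T. U i) N) (max 2 p))
       \<and> (has_squarefree_initial_ideal A (toric_ideal K T A) \<and>
            (\<forall>i\<in>T. has_squarefree_initial_ideal (B i) (toric_ideal K (U i) (B i))) \<longrightarrow>
            has_squarefree_initial_ideal N (toric_ideal K (\<Union>i\<in>T. U i) N))"
proof (intro conjI allI impI)
  have "finite T" "\<And>i. finite (U i)" "\<And>i v. v \<in> U i \<Longrightarrow> fst v = i"
    by (auto simp: T_def U_def)
  note nested = nested_divisor_generated[OF this assms(4,5,7), folded N_def]
  {
    fix p :: nat
    assume p: "has_binomial_groebner_basis A (toric_ideal K T A) p \<and>
      (\<forall>i\<in>T. has_binomial_groebner_basis (B i) (toric_ideal K (U i) (B i)) p)"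
    \<comment> \<open>The exchanges contribute generators of degree 2, so the bound in the
      hypotheses is first weakened from p to \<open>max 2 p\<close>.\<close>
    let ?q = "Some (max 2 p)"
    have weaken: "\<exists>R. monomial_order X R \<and> divisor_generated (restricted_mon ?q) (nonstandard X R)"
      if "configuration V X" "has_binomial_groebner_basis X (toric_ideal K V X) p"
      for V :: "'v set" and X
      using that(2)[unfolded has_binomial_groebner_basis_iff[OF that(1)]]
      by (fastforce simp: restricted_mon_def max.coboundedI2)
    have "\<exists>R. monomial_order N R \<and> divisor_generated (restricted_mon ?q) (nonstandard N R)"
    proof (rule nested(2))
      show "\<exists>R. monomial_order A R \<and> divisor_generated (restricted_mon ?q) (nonstandard A R)"
        using weaken[OF assms(4)] p by blast
      show "\<forall>i\<in>T. \<exists>R. monomial_order (B i) R \<and> divisor_generated (restricted_mon ?q) (nonstandard (B i) R)"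
        using weaken assms(7) p by blast
    qed auto
    then show "has_binomial_groebner_basis N (toric_ideal K (\<Union>i\<in>T. U i) N) (max 2 p)"
      using has_binomial_groebner_basis_iff[OF nested(1), of K "max 2 p"] by (simp add: restricted_mon_def)
  }
  assume s: "has_squarefree_initial_ideal A (toric_ideal K T A) \<and>
    (\<forall>i\<in>T. has_squarefree_initial_ideal (B i) (toric_ideal K (U i) (B i)))"
  have "\<exists>R. monomial_order N R \<and> divisor_generated (restricted_mon None) (nonstandard N R)"
    by (rule nested(2))
      (use s in \<open>auto simp: has_squarefree_initial_ideal_iff restricted_mon_def\<close>)
  then show "has_squarefree_initial_ideal N (toric_ideal K (\<Union>i\<in>T. U i) N)"
    by (simp add: has_squarefree_initial_ideal_iff restricted_mon_def)
qed

end
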